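(* Let $\delta\in(0,3)$ and let $\mathbb{B}^{(\delta,3-\delta)}=(\mathbb{B}^{(\delta,3-\delta)}_t)_{t\in[0,1]}$ be the generalized Bessel meander with parameters $(\delta,3-\delta)$. Let $(X_t)_{t\ge 0}$ be the Markov process on $[0,\infty)$ with transition densities $$p_t(x,y)=\frac{2t\sqrt{y}}{\pi\left[(y-x)^2+2(x+y)t^2+t^4\right]},\qquad t>0,\ x,y\ge 0,$$ with $\mathbb{E}_x$ denoting expectation when $X_0=x$. Let $d\ge 1$ be an integer, let $s_0=0<s_1<s_2<\dots<s_d$ be real numbers and let $t_0=0\le t_1<\dots<t_d\le 1=t_{d+1}$. Then $$\mathbb{E}\left[\exp\left(-\sum_{k=1}^d (s_k-s_{k-1})\mathbb{B}^{(\delta,3-\delta)}_{1-t_k}\right)\right]=\frac{1}{2^{\delta/2}\Gamma(\delta/2)}\int_0^\infty \mathbb{E}_x\left[\exp\left(-\frac12\sum_{k=0}^{d}(t_{k+1}-t_k)X_{s_k}\right)\right]x^{\delta/2-1}\,dx.$$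
   Context: Brownian excursion: $\mathbb{B}^{ex}=(\mathbb{B}^{ex}_t)_{t\in[0,1]}$ is the process (with continuous paths) with $\mathbb{B}^{ex}_0=\mathbb{B}^{ex}_1=0$ whose joint density at times $0<t_1<\dots<t_d<1$ is $$f_{t_1,\dots,t_d}(y_1,\dots,y_d)=\sqrt{8\pi}\,\ell_{t_1}(y_1)\,\ell_{1-t_d}(y_d)\prod_{k=1}^{d-1}g_{t_{k+1}-t_k}(y_k,y_{k+1}),$$ where $$\ell_t(y)=\frac{1}{\sqrt{2\pi t^3}}\,y\,e^{-y^2/(2t)}\mathbf{1}_{\{y>0\}},\qquad g_t(y_1,y_2)=\frac{1}{\sqrt{2\pi t}}\left[e^{-(y_1-y_2)^2/(2t)}-e^{-(y_1+y_2)^2/(2t)}\right]\mathbf{1}_{\{y_1,y_2>0\}}.$$ It coincides in law with the 3-dimensional Bessel bridge from $0$ to $0$ on $[0,1]$. Generalized Bessel meander: for $\delta\in(0,3)$, the process $\mathbb{B}^{(\delta,3-\delta)}$ is the randomized 3-dimensional Bessel bridge $$\mathbb{B}^{(\delta,3-\delta)}_t=\frac{1}{\sqrt{V}}\,\mathbb{B}^{ex}_{Vt},\qquad t\in[0,1],$$ where $V$ is independent of $\mathbb{B}^{ex}$ and has the Beta$(\delta/2,(3-\delta)/2)$ distribution, i.e. density proportional to $v^{\delta/2-1}(1-v)^{(3-\delta)/2-1}$ on $(0,1)$. (Equivalently, it is known that its law on $C([0,1])$ is absolutely continuous with respect to the law of the 3-dimensional Bessel process started from $0$, with density $c\,\omega_1^{-\delta}$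 at $\omega\in C([0,1])$, where $c=2^{\delta/2}\Gamma(3/2)/\Gamma((3-\delta)/2)$.) Process $X$: $(X_t)_{t\ge0}$ is the time-homogeneous Markov process with state space $[0,\infty)$ and transition probabilities $\mathbb{P}(X_t\in dy\mid X_s=x)=p_{t-s}(x,y)\,dy$ for $0\le s<t$, $x\ge 0$, with $p_t(x,y)$ as in the statement. For $x>0$, $\mathbb{E}_x$ is the expectation for the law of $(X_t)_{t\ge 0}$ started at $X_0=x$. *)

theory Defs
  imports "HOL-Probability.Probability"
begin

definition exc_entrance :: "real \<Rightarrow> real \<Rightarrow> real" where
  "exc_entrance t y =
     1 / sqrt (2 * pi * t ^ 3) * y * exp (- (y\<^sup>2 / (2 * t))) * indicator {0<..} y"

definition exc_kernel :: "real \<Rightarrow> real \<Rightarrow> real \<Rightarrow> real" where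
  "exc_kernel t y1 y2 =
     1 / sqrt (2 * pi * t)
       * (exp (- ((y1 - y2)\<^sup>2 / (2 * t))) - exp (- ((y1 + y2)\<^sup>2 / (2 * t))))
       * indicator {0<..} y1 * indicator {0<..} y2"

definition exc_density :: "nat \<Rightarrow> (nat \<Rightarrow> real) \<Rightarrow> (nat \<Rightarrow> real) \<Rightarrow> real" where
  "exc_density d t y =
     sqrt (8 * pi) * exc_entrance (t 1) (y 1) * exc_entrance (1 - t d) (y d)
       * (\<Prod>k\<in>{1..<d}. exc_kernel (t (k + 1) - t k) (y k) (y (k + 1)))"

text \<open>Processes indexed by \<open>[0,1]\<close> or \<open>[0,\<infinity>)\<close> are total functions of a real
  time; nothing is assumed about their values at other times.\<close>

definition history :: "'b measure \<Rightarrow> (real \<Rightarrow> 'b \<Rightarrow> real) \<Rightarrow> real \<Rightarrow> 'b measure" where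
  "history N X s =
     vimage_algebra (space N) (\<lambda>\<omega>. \<lambda>u\<in>{0..s}. X u \<omega>) (\<Pi>\<^sub>M u\<in>{0..s}. borel)"

definition brownian_excursion :: "'a measure \<Rightarrow> (real \<Rightarrow> 'a \<Rightarrow> real) \<Rightarrow> bool" where
  "brownian_excursion M W \<longleftrightarrow>
     prob_space M
   \<and> (\<forall>t\<in>{0..1}. W t \<in> borel_measurable M)
   \<and> (\<forall>\<omega>\<in>space M. continuous_on {0..1} (\<lambda>t. W t \<omega>) \<and> W 0 \<omega> = 0 \<and> W 1 \<omega> = 0)
   \<and> (\<forall>d\<ge>1. \<forall>t :: nat \<Rightarrow> real. 0 < t 1 \<longrightarrow> strict_mono_on {1..d} t \<longrightarrow> t d < 1 \<longrightarrow>
        distributed M (\<Pi>\<^sub>M i\<in>{1..d}. lborel) (\<lambda>\<omega>. \<lambda>i\<in>{1..d}. W (t i) \<omega>)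
          (\<lambda>y. ennreal (exc_density d t y)))"

definition beta_density :: "real \<Rightarrow> real \<Rightarrow> real \<Rightarrow> real" where
  "beta_density a b v =
     v powr (a - 1) * (1 - v) powr (b - 1) / Beta a b * indicator {0<..<1} v"

text \<open>The parameters of the meander are \<open>(\<delta>, 3 - \<delta>)\<close>. Independence is that of \<open>V\<close> and the
  whole path \<open>(W t)\<close>, \<open>t \<in> [0,1]\<close>. The representation is required almost surely because
  the density of \<open>V\<close> leaves \<open>V\<close> unconstrained on a null set, where \<open>V \<cdot> t\<close> may leave \<open>[0,1]\<close>.\<close>

definition generalized_bessel_meander ::
    "'a measure \<Rightarrow> real \<Rightarrow> (real \<Rightarrow> 'a \<Rightarrow> real) \<Rightarrow> bool" where
  "generalized_bessel_meander M \<delta> B \<longleftrightarrow>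
     (\<forall>t\<in>{0..1}. B t \<in> borel_measurable M)
   \<and> (\<exists>W V. brownian_excursion M W
        \<and> distributed M lborel V (\<lambda>v. ennreal (beta_density (\<delta> / 2) ((3 - \<delta>) / 2) v))
        \<and> prob_space.indep_set M
             (sets (vimage_algebra (space M) V borel)) (sets (history M W 1))
        \<and> (AE \<omega> in M. \<forall>t\<in>{0..1}. B t \<omega> = 1 / sqrt (V \<omega>) * W (V \<omega> * t) \<omega>))"

definition trans_density :: "real \<Rightarrow> real \<Rightarrow> real \<Rightarrow> real" where
  "trans_density t x y =
     2 * t * sqrt y / (pi * ((y - x)\<^sup>2 + 2 * (x + y) * t\<^sup>2 + t ^ 4))"

definition markov_process_from ::
    "(real \<Rightarrow> real \<Rightarrow> real \<Rightarrow> real) \<Rightarrow> 'b measure \<Rightarrow> (real \<Rightarrow> 'b \<Rightarrow> real) \<Rightarrow> real \<Rightarrow> bool" where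
  "markov_process_from p N X x \<longleftrightarrow>
     prob_space N
   \<and> (\<forall>t\<ge>0. X t \<in> borel_measurable N \<and> (\<forall>\<omega>\<in>space N. 0 \<le> X t \<omega>))
   \<and> (AE \<omega> in N. X 0 \<omega> = x)
   \<and> (\<forall>s t. 0 \<le> s \<longrightarrow> s < t \<longrightarrow> (\<forall>A\<in>sets borel.
        AE \<omega> in N. real_cond_exp N (history N X s) (indicator (X t -` A \<inter> space N)) \<omega>
                   = (LBINT y:A \<inter> {0..}. p (t - s) (X s \<omega>) y)))"

end

theory Submission
  imports Defs "HOL-Real_Asymp.Real_Asymp"
begin

text \<open>The identity expresses that the sine transform \<open>S\<close> exchanges two families of operators on
  functions on the half-line. Write \<open>x = u\<^sup>2\<close>. Then \<open>trans_density s\<close> becomes the density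
  \<open>(v / u) * q s u v\<close> in \<open>v\<close>, where \<open>q s u v\<close> is the difference of the Cauchy densities at \<open>u - v\<close> and \<open>u + v\<close>
  (\<open>sqrt X\<close> is the modulus of a three-dimensional Cauchy process). Up to the constant
  \<open>2 / \<pi>\<close>, the operator with kernel \<open>q s\<close> is \<open>S\<close>, followed by multiplication by \<open>exp (- s a)\<close>, followed by \<open>S\<close>;
  and the operator with the excursion kernel of time \<open>t\<close> is \<open>S\<close>, followed by multiplication by
  \<open>exp (- t u\<^sup>2 / 2)\<close>, followed by \<open>S\<close>.

  By the Markov property, the expectation on the right-hand side is an alternating product of
  multiplications by \<open>exp (- \<tau> u\<^sup>2 / 2)\<close> and operators \<open>q \<sigma>\<close>, where the \<open>\<tau>\<close> are the increments of
  \<open>t\<close> and the \<open>\<sigma>\<close> those of \<open>s\<close>. Regrouped around the transforms \<open>S\<close>, the same product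
  consists of multiplications by \<open>exp (- \<sigma> a)\<close> and excursion kernels of times \<open>\<tau>\<close>, which is the
  Laplace functional of an excursion with weights \<open>\<sigma>\<close> (\<open>chain_duality\<close>). The factor \<open>v / u\<close>
  leaves the function \<open>u\<close> at the inner end of the product; its transform, after the last Gaussian weight, is the
  entrance density of the excursion. If the outer end is integrated against
  \<open>u * exp (- r u\<^sup>2 / 2)\<close>, it gives an entrance density too, and the result belongs to an
  excursion of length \<open>1 + r\<close> (\<open>chain_duality_last\<close>).

  By scaling, an excursion of length \<open>1 + r\<close> is \<open>W (v t) / sqrt v\<close> with \<open>v = 1 / (1 + r)\<close>
  (\<open>scaled_excursion_laplace\<close>), so the meander is a mixture of such excursions, and the Beta law of \<open>V\<close>
  corresponds to the weight \<open>r powr ((3 - \<delta>) / 2 - 1)\<close> in \<open>r\<close>. A Gamma integral then replaces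
  \<open>u * exp (- r u\<^sup>2 / 2)\<close> by a multiple of \<open>u powr (\<delta> - 2)\<close> (\<open>beta_mixture_gaussian\<close>), which is
  the weight \<open>x powr (\<delta> / 2 - 1)\<close> in the coordinate \<open>u\<close>, divided by the \<open>u\<close> that remains from
  \<open>v / u\<close> at the outer end.\<close>

section \<open>Sine transforms of exponential and Gaussian functions\<close>

definition sine_transform :: "(real \<Rightarrow> real) \<Rightarrow> real \<Rightarrow> real" where
  "sine_transform f a = (LINT v|lborel. sin (a * v) * f v)"

lemma abs_sin_mult_le: "\<bar>sin x * y\<bar> \<le> \<bar>y\<bar>" for x y :: real
  unfolding abs_mult by (rule mult_left_le_one_le) auto

lemma integrable_sin_mult:
  fixes f :: "real \<Rightarrow> real"
  assumes "integrable lborel f"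
  shows "integrable lborel (\<lambda>v. sin (a * v) * f v)"
proof (rule Bochner_Integration.integrable_bound[OF assms])
  have [measurable]: "f \<in> borel_measurable borel"
    using assms by (auto dest: borel_measurable_integrable)
  show "(\<lambda>v. sin (a * v) * f v) \<in> borel_measurable lborel" by measurable
qed (simp add: abs_sin_mult_le)

lemma borel_measurable_sine_transform [measurable]:
  assumes [measurable]: "f \<in> borel_measurable borel"
  shows "sine_transform f \<in> borel_measurable borel"
  unfolding sine_transform_def by measurable

lemma abs_sine_transform_le:
  assumes "integrable lborel f"
  shows "\<bar>sine_transform f a\<bar> \<le> (LINT v|lborel. \<bar>f v\<bar>)"
proof -
  have "\<bar>sine_transform f a\<bar> \<le> (LINT v|lborel. \<bar>sin (a * v) * f v\<bar>)"
    unfolding sine_transform_def by (rule integral_abs_bound)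
  also have "\<dots> \<le> (LINT v|lborel. \<bar>f v\<bar>)"
    by (intro integral_mono integrable_abs integrable_sin_mult assms)
       (rule abs_sin_mult_le)
  finally show ?thesis .
qed

text \<open>The sine transform is symmetric with respect to the Lebesgue pairing, because its kernel
  \<open>sin (a * v)\<close> is symmetric and bounded. Every exchange of integrals in the duality
  below is an instance of this lemma.\<close>

lemma sine_transform_parseval:
  assumes f: "integrable lborel f" and g: "integrable lborel g"
  shows "(LINT a|lborel. f a * sine_transform g a) = (LINT v|lborel. sine_transform f v * g v)"
proof -
  have [measurable]: "f \<in> borel_measurable borel" "g \<in> borel_measurable borel"
    using f g by (auto dest: borel_measurable_integrable)
  have int: "integrable (lborel \<Otimes>\<^sub>M lborel) (\<lambda>(v, a). sin (v * a) * f a * g v)"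
  proof (rule lborel_pair.Fubini_integrable)
    have m: "integrable lborel (\<lambda>a. sin (v * a) * f a * g v)" for v
      by (intro integrable_mult_left integrable_sin_mult f)
    then show "AE v in lborel. integrable lborel (\<lambda>a. case (v, a) of (v, a) \<Rightarrow> sin (v * a) * f a * g v)"
      by simp
    show "integrable lborel (\<lambda>v. LINT a|lborel. norm (case (v, a) of (v, a) \<Rightarrow> sin (v * a) * f a * g v))"
    proof (rule Bochner_Integration.integrable_bound)
      show "integrable lborel (\<lambda>v. (LINT a|lborel. \<bar>f a\<bar>) * \<bar>g v\<bar>)"
        by (intro integrable_mult_right integrable_abs g)
      show "AE v in lborel. norm (LINT a|lborel. norm (case (v, a) of (v, a) \<Rightarrow> sin (v * a) * f a * g v))
          \<le> norm ((LINT a|lborel. \<bar>f a\<bar>) * \<bar>g v\<bar>)"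
      proof (rule AE_I2)
        fix v
        have "(LINT a|lborel. \<bar>sin (v * a) * f a * g v\<bar>) \<le> (LINT a|lborel. \<bar>f a\<bar> * \<bar>g v\<bar>)"
          by (intro integral_mono integrable_abs m integrable_mult_left f)
             (simp add: mult.assoc abs_sin_mult_le flip: abs_mult)
        then show "norm (LINT a|lborel. norm (case (v, a) of (v, a) \<Rightarrow> sin (v * a) * f a * g v))
          \<le> norm ((LINT a|lborel. \<bar>f a\<bar>) * \<bar>g v\<bar>)"
          by (simp add: integral_nonneg_AE abs_mult)
      qed
    qed simp
  qed simp
  have "(LINT a|lborel. f a * sine_transform g a)
      = (LINT a|lborel. LINT v|lborel. sin (v * a) * f a * g v)"
    unfolding sine_transform_def
    by (subst integral_mult_right_zero[symmetric]) (simp add: ac_simps)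
  also have "\<dots> = (LINT v|lborel. LINT a|lborel. sin (v * a) * f a * g v)"
    using lborel_pair.Fubini_integral[OF int] .
  also have "\<dots> = (LINT v|lborel. sine_transform f v * g v)"
    unfolding sine_transform_def by (subst integral_mult_left_zero[symmetric]) (simp add: ac_simps)
  finally show ?thesis .
qed

lemma tendsto_at_right_isCont:
  fixes F :: "real \<Rightarrow> real"
  assumes "isCont F x" "F x = A"
  shows "(F \<longlongrightarrow> A) (at_right x)"
  using assms unfolding isCont_def by (auto intro: tendsto_within_subset)

text \<open>Most of the integrands below oscillate, so integrability has to be supplied; for a
  nonnegative integrand it comes for free, which is the next lemma.\<close>

lemma integral_half_line_FTC:
  fixes f F :: "real \<Rightarrow> real"
  assumes F: "\<And>x. x > 0 \<Longrightarrow> (F has_real_derivative f x) (at x)"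
    and f: "\<And>x. x > 0 \<Longrightarrow> isCont f x"
    and int: "integrable lborel (\<lambda>x. f x * indicator {0<..} x)"
    and A: "(F \<longlongrightarrow> A) (at_right 0)" and B: "(F \<longlongrightarrow> B) at_top"
  shows "(LINT x|lborel. f x * indicator {0<..} x) = B - A"
proof -
  have e: "einterval 0 \<infinity> = {0<..}" by (auto simp: einterval_def)
  have "(LBINT x=0..\<infinity>. f x) = B - A"
  proof (rule interval_integral_FTC_integrable)
    show "((F \<circ> real_of_ereal) \<longlongrightarrow> A) (at_right 0)"
      using A unfolding zero_ereal_def ereal_tendsto_simps1 .
    show "((F \<circ> real_of_ereal) \<longlongrightarrow> B) (at_left \<infinity>)"
      using B unfolding ereal_tendsto_simps1 .
    show "set_integrable lborel (einterval 0 \<infinity>) f"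
      using int unfolding e set_integrable_def by (simp add: mult.commute)
  qed (use F f in \<open>auto simp: has_real_derivative_iff_has_vector_derivative\<close>)
  then show ?thesis
    by (simp add: interval_lebesgue_integral_def e set_lebesgue_integral_def mult.commute)
qed

lemma integrable_half_line_FTC:
  fixes f F :: "real \<Rightarrow> real"
  assumes F: "\<And>x. x > 0 \<Longrightarrow> (F has_real_derivative f x) (at x)"
    and f: "\<And>x. x > 0 \<Longrightarrow> isCont f x" and f0: "\<And>x. x > 0 \<Longrightarrow> 0 \<le> f x"
    and A: "(F \<longlongrightarrow> A) (at_right 0)" and B: "(F \<longlongrightarrow> B) at_top"
  shows "integrable lborel (\<lambda>x. f x * indicator {0<..} x)"
proof -
  have e: "einterval 0 \<infinity> = {0<..}" by (auto simp: einterval_def)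
  have "set_integrable lborel (einterval 0 \<infinity>) f"
  proof (rule interval_integral_FTC_nonneg(1)[where F=F])
    show "((F \<circ> real_of_ereal) \<longlongrightarrow> A) (at_right 0)"
      using A unfolding zero_ereal_def ereal_tendsto_simps1 .
    show "((F \<circ> real_of_ereal) \<longlongrightarrow> B) (at_left \<infinity>)"
      using B unfolding ereal_tendsto_simps1 .
  qed (use F f f0 in auto)
  then show ?thesis by (simp add: e set_integrable_def mult.commute)
qed

lemma integrable_exp_decay:
  assumes "(0::real) < s"
  shows "integrable lborel (\<lambda>x. exp (- (s * x)) * indicator {0<..} x)"
proof (rule integrable_half_line_FTC[where F = "\<lambda>x. - exp (- (s * x)) / s" and A = "- inverse s" and B = 0])
  show "((\<lambda>x. - exp (- (s * x)) / s) \<longlongrightarrow> 0) at_top" using assms by real_asymp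
  show "((\<lambda>x. - exp (- (s * x)) / s) \<longlongrightarrow> - inverse s) (at_right 0)"
    using assms by real_asymp
qed (auto intro!: derivative_eq_intros continuous_intros simp: assms less_imp_neq[OF assms, symmetric])

lemma integrable_gaussian_moment:
  assumes "(0::real) < c"
  shows "integrable lborel (\<lambda>x. x * exp (- (c * x\<^sup>2 / 2)) * indicator {0<..} x)"
proof (rule integrable_half_line_FTC[where F = "\<lambda>x. - exp (- (c * x\<^sup>2 / 2)) / c" and A = "- inverse c" and B = 0])
  show "((\<lambda>x. - exp (- (c * x\<^sup>2 / 2)) / c) \<longlongrightarrow> 0) at_top" using assms by real_asymp
  show "((\<lambda>x. - exp (- (c * x\<^sup>2 / 2)) / c) \<longlongrightarrow> - inverse c) (at_right 0)"
    using assms by real_asymp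
qed (use assms in \<open>auto intro!: derivative_eq_intros continuous_intros simp: field_simps power2_eq_square\<close>)

lemma integrable_cos_exp_decay:
  assumes "(0::real) < s"
  shows "integrable lborel (\<lambda>x. exp (- (s * x)) * cos (z * x) * indicator {0<..} x)"
  by (rule Bochner_Integration.integrable_bound[OF integrable_exp_decay[OF assms]])
     (auto simp: abs_mult indicator_def intro!: AE_I2)

lemma integral_cos_exp_decay:
  assumes s: "(0::real) < s"
  shows "(LINT x|lborel. exp (- (s * x)) * cos (z * x) * indicator {0<..} x) = s / (z\<^sup>2 + s\<^sup>2)"
proof -
  let ?F = "\<lambda>x. exp (- (s * x)) * (z * sin (z * x) - s * cos (z * x)) / (z\<^sup>2 + s\<^sup>2)"
  have D: "z\<^sup>2 + s\<^sup>2 > 0" using s by (simp add: add_nonneg_pos)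
  have "(LINT x|lborel. exp (- (s * x)) * cos (z * x) * indicator {0<..} x) = 0 - (- s / (z\<^sup>2 + s\<^sup>2))"
  proof (rule integral_half_line_FTC[where F = ?F])
    fix x :: real
    show "(?F has_real_derivative exp (- (s * x)) * cos (z * x)) (at x)"
    proof -
      have "((\<lambda>x. exp (- (s * x)) * (z * sin (z * x) - s * cos (z * x))) has_real_derivative
          (z\<^sup>2 + s\<^sup>2) * (exp (- (s * x)) * cos (z * x))) (at x)"
        by (rule derivative_eq_intros refl)+ (simp add: algebra_simps power2_eq_square)
      from DERIV_cdivide[OF this, of "z\<^sup>2 + s\<^sup>2"] D less_imp_neq[OF D, symmetric] s show ?thesis by simp
    qed
    show "(?F \<longlongrightarrow> - s / (z\<^sup>2 + s\<^sup>2)) (at_right 0)"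
      by (rule tendsto_at_right_isCont) (use D in \<open>auto intro!: continuous_intros\<close>)
    have E: "((\<lambda>x. exp (- (s * x)) * (\<bar>z\<bar> + s)) \<longlongrightarrow> 0) at_top" using s by real_asymp
    have "((\<lambda>x. exp (- (s * x)) * (z * sin (z * x) - s * cos (z * x))) \<longlongrightarrow> 0) at_top"
    proof (rule Lim_null_comparison[OF _ E], rule always_eventually, rule allI)
      fix x
      have "\<bar>z * sin (z * x) - s * cos (z * x)\<bar> \<le> \<bar>z * sin (z * x)\<bar> + \<bar>s * cos (z * x)\<bar>"
        by (rule abs_triangle_ineq4)
      also have "\<dots> \<le> \<bar>z\<bar> * 1 + s * 1"
        unfolding abs_mult using s by (intro add_mono mult_mono) auto
      finally show "norm (exp (- (s * x)) * (z * sin (z * x) - s * cos (z * x))) \<le> exp (- (s * x)) * (\<bar>z\<bar> + s)"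
        by (simp add: abs_mult)
    qed
    from tendsto_divide[OF this tendsto_const less_imp_neq[OF D, symmetric]]
    show "(?F \<longlongrightarrow> 0) at_top" by simp
  qed (auto intro!: continuous_intros integrable_cos_exp_decay s)
  then show ?thesis by simp
qed

text \<open>Twice the odd part, in \<open>v\<close>, of the Cauchy density at distance \<open>u - v\<close>. Multiplied by
  \<open>v / u\<close> it is the transition density of the modulus of a three-dimensional Cauchy process.\<close>

definition cauchy_kernel :: "real \<Rightarrow> real \<Rightarrow> real \<Rightarrow> real" where
  "cauchy_kernel s u v = s / pi * (1 / ((u - v)\<^sup>2 + s\<^sup>2) - 1 / ((u + v)\<^sup>2 + s\<^sup>2))"

lemma sin_mult_sin_mult:
  "sin (v * b) * (p * sin (u * b) * i) = (p * cos ((u - v) * b) * i - p * cos ((u + v) * b) * i) / (2::real)"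
  "sin (b * v) * (sin (u * v) * p * i) = (cos ((u - b) * v) * p * i - cos ((u + b) * v) * p * i) / (2::real)"
proof -
  have "sin x * sin y = (cos (y - x) - cos (y + x)) / 2" for x y :: real
    by (simp add: cos_add cos_diff)
  then have *: "sin x * (sin y * q) = (cos (y - x) * q - cos (y + x) * q) / 2" for x y q :: real
    by (simp flip: left_diff_distrib mult.assoc)
  show "sin (v * b) * (p * sin (u * b) * i) = (p * cos ((u - v) * b) * i - p * cos ((u + v) * b) * i) / (2::real)"
    using *[of "v * b" "u * b" "p * i"] by (simp add: ring_distribs mult.assoc mult.left_commute[of _ p])
  show "sin (b * v) * (sin (u * v) * p * i) = (cos ((u - b) * v) * p * i - cos ((u + b) * v) * p * i) / (2::real)"
    using *[of "b * v" "u * v" "p * i"] by (simp add: ring_distribs mult.assoc)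
qed

text \<open>The kernel \<open>cauchy_kernel s\<close> is diagonalised by the sine transform, with spectral
  multiplier \<open>exp (- s b)\<close>.\<close>

lemma sine_transform_exp_decay:
  assumes s: "0 < s"
  shows "sine_transform (\<lambda>b. exp (- (s * b)) * sin (u * b) * indicator {0<..} b) v = pi / 2 * cauchy_kernel s u v"
proof -
  have "sine_transform (\<lambda>b. exp (- (s * b)) * sin (u * b) * indicator {0<..} b) v
     = (LINT b|lborel. (exp (- (s * b)) * cos ((u - v) * b) * indicator {0<..} b
           - exp (- (s * b)) * cos ((u + v) * b) * indicator {0<..} b) / 2)"
    unfolding sine_transform_def
    by (intro Bochner_Integration.integral_cong refl sin_mult_sin_mult)
  also have "\<dots> = (s / ((u - v)\<^sup>2 + s\<^sup>2) - s / ((u + v)\<^sup>2 + s\<^sup>2)) / 2"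
    by (simp add: integral_cos_exp_decay integrable_cos_exp_decay s)
  also have "\<dots> = pi / 2 * cauchy_kernel s u v"
    unfolding cauchy_kernel_def by (simp add: right_diff_distrib diff_divide_distrib mult.commute)
  finally show ?thesis .
qed

lemma integrable_gaussian:
  assumes "(0::real) < c"
  shows "integrable lborel (\<lambda>x. exp (- (c * x\<^sup>2 / 2)))"
proof -
  have "integrable lborel (\<lambda>x. sqrt (2 * pi * (1 / sqrt c)\<^sup>2) * normal_density 0 (1 / sqrt c) x)"
    using assms by (intro integrable_mult_right integrable_normal_density) auto
  also have "(\<lambda>x. sqrt (2 * pi * (1 / sqrt c)\<^sup>2) * normal_density 0 (1 / sqrt c) x) = (\<lambda>x. exp (- (c * x\<^sup>2 / 2)))"
    using assms by (auto simp: fun_eq_iff normal_density_def power_divide field_simps)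
  finally show ?thesis .
qed

lemma integrable_cos_gaussian:
  assumes "(0::real) < c"
  shows "integrable lborel (\<lambda>x. cos (z * x) * exp (- (c * x\<^sup>2 / 2)))"
  by (rule Bochner_Integration.integrable_bound[OF integrable_gaussian[OF assms]])
     (auto simp: abs_mult intro!: AE_I2)

lemma integrable_cos_gaussian_half:
  assumes "(0::real) < c"
  shows "integrable lborel (\<lambda>x. cos (z * x) * exp (- (c * x\<^sup>2 / 2)) * indicator {0<..} x)"
  using integrable_real_mult_indicator[OF _ integrable_cos_gaussian[OF assms], of "{0<..}"] by simp

lemma integral_cos_std_normal:
  "(LINT x|lborel. cos (z * x) * std_normal_density x) = exp (- (z\<^sup>2 / 2))"
proof -
  have int: "complex_integrable lborel (\<lambda>x. std_normal_density x *\<^sub>R iexp (z * x))"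
  proof (rule Bochner_Integration.integrable_bound[OF integrable_normal_density[of 1 0]])
    show "AE x in lborel. norm (std_normal_density x *\<^sub>R iexp (z * x)) \<le> norm (std_normal_density x)"
      by (simp add: norm_exp_i_times)
  qed simp_all
  have "exp (- (z\<^sup>2 / 2)) = Re (char std_normal_distribution z)"
    by (simp add: char_std_normal_distribution)
  also have "char std_normal_distribution z = (LINT x|lborel. std_normal_density x *\<^sub>R iexp (z * x))"
    unfolding char_def by (rule integral_density) (simp_all add: normal_density_nonneg)
  also have "Re \<dots> = (LINT x|lborel. Re (std_normal_density x *\<^sub>R iexp (z * x)))"
    by (rule integral_Re[OF int, symmetric])
  also have "\<dots> = (LINT x|lborel. cos (z * x) * std_normal_density x)"
    by (intro Bochner_Integration.integral_cong refl) (simp add: Re_exp)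
  finally show ?thesis by simp
qed

text \<open>The integrand is even, so this is half of an integral over the line, which up to
  normalisation is the characteristic function of the centred normal law of variance \<open>1 / c\<close>.\<close>

lemma integral_cos_gaussian_half:
  assumes c: "(0::real) < c"
  shows "(LINT x|lborel. cos (z * x) * exp (- (c * x\<^sup>2 / 2)) * indicator {0<..} x)
    = sqrt (2 * pi / c) / 2 * exp (- (z\<^sup>2 / (2 * c)))"
proof -
  let ?f = "\<lambda>x. cos (z * x) * exp (- (c * x\<^sup>2 / 2))"
  have "exp (- ((z / sqrt c)\<^sup>2 / 2)) = (LINT x|lborel. cos (z / sqrt c * x) * std_normal_density x)"
    by (rule integral_cos_std_normal[symmetric])
  also have "\<dots> = sqrt c * (LINT x|lborel. cos (z / sqrt c * (0 + sqrt c * x)) * std_normal_density (0 + sqrt c * x))"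
    using lborel_integral_real_affine[of "sqrt c" "\<lambda>x. cos (z / sqrt c * x) * std_normal_density x" 0] c by simp
  also have "\<dots> = sqrt c * (LINT x|lborel. 1 / sqrt (2 * pi) * ?f x)"
    using c by (intro arg_cong[where f="\<lambda>x. sqrt c * x"] Bochner_Integration.integral_cong refl)
      (simp add: std_normal_density_def power_mult_distrib)
  finally have 1: "(LINT x|lborel. ?f x) = sqrt (2 * pi / c) * exp (- (z\<^sup>2 / (2 * c)))"
    using c by (simp add: field_simps real_sqrt_mult real_sqrt_divide power_divide)
  have "(LINT x|lborel. ?f x * indicator {0<..} x) = (LINT x|lborel. ?f x * indicator {..<0} x)"
    by (subst lborel_integral_real_affine[of "-1" _ 0])
       (auto simp: indicator_def intro!: Bochner_Integration.integral_cong)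
  moreover have "(LINT x|lborel. ?f x) = (LINT x|lborel. ?f x * indicator {0<..} x + ?f x * indicator {..<0} x)"
    by (intro integral_cong_AE)
       (auto simp: indicator_def intro: AE_mp[OF AE_lborel_singleton[of 0]])
  moreover have "\<dots> = (LINT x|lborel. ?f x * indicator {0<..} x) + (LINT x|lborel. ?f x * indicator {..<0} x)"
    using integrable_real_mult_indicator[OF _ integrable_cos_gaussian[OF c, of z], of "{..<0}"]
    by (intro Bochner_Integration.integral_add integrable_cos_gaussian_half c) simp
  ultimately show ?thesis using 1 by simp
qed

text \<open>Here the roles are exchanged: a Gaussian multiplier between two sine transforms produces
  the transition kernel of the excursion, that is, of Brownian motion killed at zero.\<close>

lemma sine_transform_gaussian:
  assumes c: "0 < c" and ab: "0 < a" "0 < b"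
  shows "sine_transform (\<lambda>v. sin (a * v) * exp (- (c * v\<^sup>2 / 2)) * indicator {0<..} v) b
    = pi / 2 * exc_kernel c a b"
proof -
  have sq: "sqrt (2 * pi / c) / 4 = pi / 2 * (1 / sqrt (2 * pi * c))"
    using c by (simp add: real_sqrt_mult real_sqrt_divide field_simps)
  have "sine_transform (\<lambda>v. sin (a * v) * exp (- (c * v\<^sup>2 / 2)) * indicator {0<..} v) b
     = (LINT v|lborel. (cos ((a - b) * v) * exp (- (c * v\<^sup>2 / 2)) * indicator {0<..} v
           - cos ((a + b) * v) * exp (- (c * v\<^sup>2 / 2)) * indicator {0<..} v) / 2)"
    unfolding sine_transform_def
    by (intro Bochner_Integration.integral_cong refl sin_mult_sin_mult)
  also have "\<dots> = (sqrt (2 * pi / c) / 4) * (exp (- ((a - b)\<^sup>2 / (2 * c))) - exp (- ((a + b)\<^sup>2 / (2 * c))))"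
    by (simp add: integral_cos_gaussian_half integrable_cos_gaussian_half c right_diff_distrib diff_divide_distrib)
  also have "\<dots> = pi / 2 * exc_kernel c a b"
    using ab unfolding sq by (simp add: exc_kernel_def)
  finally show ?thesis .
qed

text \<open>Integration by parts: up to a multiple of the cosine integral above, the integrand is a
  multiple of the derivative of \<open>exp (- c v\<^sup>2 / 2) sin (a v)\<close>, which vanishes at both ends. This is where the
  entrance density of the excursion comes from.\<close>

lemma sine_transform_gaussian_moment:
  assumes c: "0 < c" and a: "0 < a"
  shows "sine_transform (\<lambda>v. v * exp (- (c * v\<^sup>2 / 2)) * indicator {0<..} v) a = pi * exc_entrance c a"
proof -
  let ?F = "\<lambda>v. - (1 / c) * (exp (- (c * v\<^sup>2 / 2)) * sin (a * v))"
  let ?f = "\<lambda>v. sin (a * v) * (v * exp (- (c * v\<^sup>2 / 2))) - a / c * (cos (a * v) * exp (- (c * v\<^sup>2 / 2)))"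
  have i1: "integrable lborel (\<lambda>v. sin (a * v) * (v * exp (- (c * v\<^sup>2 / 2)) * indicator {0<..} v))"
    by (intro integrable_sin_mult integrable_gaussian_moment c)
  have i2: "integrable lborel (\<lambda>v. a / c * (cos (a * v) * exp (- (c * v\<^sup>2 / 2)) * indicator {0<..} v))"
    by (intro integrable_mult_right integrable_cos_gaussian_half c)
  have e: "?f v * indicator {0<..} v = sin (a * v) * (v * exp (- (c * v\<^sup>2 / 2)) * indicator {0<..} v)
      - a / c * (cos (a * v) * exp (- (c * v\<^sup>2 / 2)) * indicator {0<..} v)" for v
    by (simp add: algebra_simps)
  have "(LINT v|lborel. ?f v * indicator {0<..} v) = 0 - 0"
  proof (rule integral_half_line_FTC[where F = ?F])
    show "(?F has_real_derivative ?f x) (at x)" for x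
    proof -
      have "((\<lambda>v. exp (- (c * v\<^sup>2 / 2)) * sin (a * v)) has_real_derivative
          a * (cos (a * x) * exp (- (c * x\<^sup>2 / 2))) - c * (sin (a * x) * (x * exp (- (c * x\<^sup>2 / 2))))) (at x)"
        by (auto intro!: derivative_eq_intros simp: algebra_simps)
      from DERIV_cmult[OF this, of "- (1 / c)"] c show ?thesis by (simp add: algebra_simps)
    qed
    show "integrable lborel (\<lambda>v. ?f v * indicator {0<..} v)"
      unfolding e by (intro Bochner_Integration.integrable_diff i1 i2)
    show "(?F \<longlongrightarrow> 0) (at_right 0)"
      by (rule tendsto_at_right_isCont) (use c in \<open>auto intro!: continuous_intros\<close>)
    have E: "((\<lambda>x. 1 / c * exp (- (c * x\<^sup>2 / 2))) \<longlongrightarrow> 0) at_top" using c by real_asymp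
    show "(?F \<longlongrightarrow> 0) at_top"
      by (rule Lim_null_comparison[OF _ E])
         (use c in \<open>auto simp: abs_mult field_simps intro!: always_eventually\<close>)
  qed (auto intro!: continuous_intros simp: less_imp_neq[OF c, symmetric])
  then have "sine_transform (\<lambda>v. v * exp (- (c * v\<^sup>2 / 2)) * indicator {0<..} v) a
     = a / c * (LINT v|lborel. cos (a * v) * exp (- (c * v\<^sup>2 / 2)) * indicator {0<..} v)"
    unfolding e sine_transform_def using i1 i2 by simp
  also have "\<dots> = a / c * (sqrt (2 * pi / c) / 2) * exp (- (a\<^sup>2 / (2 * c)))"
    by (simp add: integral_cos_gaussian_half c)
  also have "a / c * (sqrt (2 * pi / c) / 2) = pi * (1 / sqrt (2 * pi * c ^ 3) * a)"
  proof -
    have "sqrt (2 * pi * c ^ 3) = c * sqrt (2 * pi * c)"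
      using c by (simp add: power3_eq_cube real_sqrt_mult)
    then show ?thesis
      using c by (simp add: real_sqrt_mult real_sqrt_divide field_simps)
  qed
  finally show ?thesis
    using a by (simp add: exc_entrance_def)
qed

section \<open>Duality of Cauchy and excursion kernels\<close>

lemma exc_entrance_nonneg: "0 < t \<Longrightarrow> 0 \<le> exc_entrance t y"
  by (auto simp: exc_entrance_def indicator_def)

lemma exc_kernel_nonneg:
  assumes "0 < t" shows "0 \<le> exc_kernel t a b"
proof (cases "0 < a \<and> 0 < b")
  case True
  then have "(a - b)\<^sup>2 \<le> (a + b)\<^sup>2" by (simp add: power2_eq_square algebra_simps)
  then have "exp (- ((a + b)\<^sup>2 / (2 * t))) \<le> exp (- ((a - b)\<^sup>2 / (2 * t)))"
    using assms by (simp add: divide_right_mono)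
  then show ?thesis using assms True by (simp add: exc_kernel_def)
qed (auto simp: exc_kernel_def)

lemma exc_kernel_commute: "exc_kernel t a b = exc_kernel t b a"
  by (simp add: exc_kernel_def power2_commute[of a b] add.commute)

lemma cauchy_kernel_eq:
  assumes "0 < s"
  shows "cauchy_kernel s u v = s / pi * (4 * u * v / (((u - v)\<^sup>2 + s\<^sup>2) * ((u + v)\<^sup>2 + s\<^sup>2)))"
proof -
  have "(u - v)\<^sup>2 + s\<^sup>2 \<noteq> 0" "(u + v)\<^sup>2 + s\<^sup>2 \<noteq> 0"
    using assms by (auto simp: add_nonneg_eq_0_iff)
  then have "1 / ((u - v)\<^sup>2 + s\<^sup>2) - 1 / ((u + v)\<^sup>2 + s\<^sup>2)
    = ((u + v)\<^sup>2 - (u - v)\<^sup>2) / (((u - v)\<^sup>2 + s\<^sup>2) * ((u + v)\<^sup>2 + s\<^sup>2))"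
    by (simp add: diff_frac_eq)
  then show ?thesis
    unfolding cauchy_kernel_def by (simp add: power2_eq_square algebra_simps)
qed

lemma cauchy_kernel_nonneg: "0 < s \<Longrightarrow> 0 < u \<Longrightarrow> 0 < v \<Longrightarrow> 0 \<le> cauchy_kernel s u v"
  by (simp add: cauchy_kernel_eq)

lemma measurable_kernels [measurable]:
  "(\<lambda>(x, y). exc_kernel t x y) \<in> borel_measurable (borel \<Otimes>\<^sub>M borel)"
  "(\<lambda>(x, y). cauchy_kernel t x y) \<in> borel_measurable (borel \<Otimes>\<^sub>M borel)"
  "(\<lambda>(x, y). trans_density t x y) \<in> borel_measurable (borel \<Otimes>\<^sub>M borel)"
  "exc_entrance t \<in> borel_measurable borel"
  unfolding exc_kernel_def cauchy_kernel_def trans_density_def exc_entrance_def by measurable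

text \<open>The excursion side of the duality: alternating products of exponential weights and
  excursion kernels, started from the entrance density. The times are run through from the
  end, so \<open>\<sigma> j\<close> and \<open>\<tau> j\<close> will be \<open>s (d - j) - s (d - j - 1)\<close> and \<open>t (d + 1 - j) - t (d - j)\<close>.\<close>

primrec excursion_chain :: "(nat \<Rightarrow> real) \<Rightarrow> (nat \<Rightarrow> real) \<Rightarrow> nat \<Rightarrow> real \<Rightarrow> real" where
  "excursion_chain \<sigma> \<tau> 0 a = exp (- (\<sigma> 0 * a)) * exc_entrance (\<tau> 0) a"
| "excursion_chain \<sigma> \<tau> (Suc j) a = exp (- (\<sigma> (Suc j) * a)) *
     (LINT b|lborel. exc_kernel (\<tau> (Suc j)) a b * excursion_chain \<sigma> \<tau> j b)"

text \<open>The other side: alternating products of Gaussian weights and Cauchy kernels, started from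
  the function \<open>u\<close>, which is the harmonic function that relates \<open>cauchy_kernel\<close> to
  \<open>trans_density\<close>.\<close>

primrec cauchy_chain :: "(nat \<Rightarrow> real) \<Rightarrow> (nat \<Rightarrow> real) \<Rightarrow> nat \<Rightarrow> real \<Rightarrow> real" where
  "cauchy_chain \<sigma> \<tau> 0 u = u * exp (- (\<tau> 0 * u\<^sup>2 / 2)) * indicator {0<..} u"
| "cauchy_chain \<sigma> \<tau> (Suc j) u = exp (- (\<tau> (Suc j) * u\<^sup>2 / 2)) * indicator {0<..} u *
     (LINT v|lborel. cauchy_kernel (\<sigma> j) u v * cauchy_chain \<sigma> \<tau> j v)"

lemma measurable_excursion_chain [measurable]: "excursion_chain \<sigma> \<tau> j \<in> borel_measurable borel"
proof (induction j)
  case 0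
  have "excursion_chain \<sigma> \<tau> 0 = (\<lambda>a. exp (- (\<sigma> 0 * a)) * exc_entrance (\<tau> 0) a)" by (simp add: fun_eq_iff)
  then show ?case by simp
next
  case (Suc j)
  note [measurable] = Suc
  have "excursion_chain \<sigma> \<tau> (Suc j) = (\<lambda>a. exp (- (\<sigma> (Suc j) * a)) *
     (LINT b|lborel. exc_kernel (\<tau> (Suc j)) a b * excursion_chain \<sigma> \<tau> j b))" by (simp add: fun_eq_iff)
  then show ?case by simp
qed

lemma measurable_cauchy_chain [measurable]: "cauchy_chain \<sigma> \<tau> j \<in> borel_measurable borel"
proof (induction j)
  case 0
  have "cauchy_chain \<sigma> \<tau> 0 = (\<lambda>u. u * exp (- (\<tau> 0 * u\<^sup>2 / 2)) * indicator {0<..} u)" by (simp add: fun_eq_iff)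
  then show ?case by simp
next
  case (Suc j)
  note [measurable] = Suc
  have "cauchy_chain \<sigma> \<tau> (Suc j) = (\<lambda>u. exp (- (\<tau> (Suc j) * u\<^sup>2 / 2)) * indicator {0<..} u *
     (LINT v|lborel. cauchy_kernel (\<sigma> j) u v * cauchy_chain \<sigma> \<tau> j v))" by (simp add: fun_eq_iff)
  then show ?case by simp
qed

lemma excursion_chain_eq_0: "a \<le> 0 \<Longrightarrow> excursion_chain \<sigma> \<tau> j a = 0"
  by (cases j) (auto simp: exc_entrance_def exc_kernel_def)

lemma cauchy_chain_eq_0: "u \<le> 0 \<Longrightarrow> cauchy_chain \<sigma> \<tau> j u = 0"
  by (cases j) auto

lemma excursion_chain_nonneg:
  "(\<And>i. i \<le> j \<Longrightarrow> 0 < \<tau> i) \<Longrightarrow> 0 \<le> excursion_chain \<sigma> \<tau> j a"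
  by (induction j arbitrary: a)
     (auto simp: exc_entrance_nonneg intro!: mult_nonneg_nonneg integral_nonneg_AE exc_kernel_nonneg)

lemma cauchy_chain_nonneg:
  assumes "\<And>i. i < j \<Longrightarrow> 0 < \<sigma> i"
  shows "0 \<le> cauchy_chain \<sigma> \<tau> j u"
  using assms
proof (induction j arbitrary: u)
  case (Suc j)
  have "0 \<le> cauchy_kernel (\<sigma> j) u v * cauchy_chain \<sigma> \<tau> j v" if "0 < u" for v
    using Suc that by (cases "0 < v") (auto simp: cauchy_chain_eq_0 cauchy_kernel_nonneg)
  then show ?case by (auto simp: indicator_def intro!: mult_nonneg_nonneg integral_nonneg_AE)
qed (simp add: indicator_def)

text \<open>Parseval moves the sine transform from the kernel to \<open>f\<close>.\<close>

lemma integral_cauchy_kernel: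
  assumes f: "integrable lborel f" and s: "0 < s"
  shows "(LINT v|lborel. cauchy_kernel s u v * f v)
    = 2 / pi * (LINT b|lborel. exp (- (s * b)) * sin (u * b) * indicator {0<..} b * sine_transform f b)"
proof -
  have int: "integrable lborel (\<lambda>b. exp (- (s * b)) * sin (u * b) * indicator {0<..} b)"
    using integrable_sin_mult[OF integrable_exp_decay[OF s], of u] by (simp add: ac_simps)
  show ?thesis
    unfolding sine_transform_parseval[OF int f] sine_transform_exp_decay[OF s]
    by (simp add: mult.assoc)
qed

text \<open>If level \<open>j\<close> of the two chains corresponds under the sine transform, the integral against
  the Cauchy kernel absorbs the factor \<open>exp (- \<sigma> j b)\<close> and becomes
  a sine transform of the other chain.\<close>

lemma cauchy_chain_Suc:
  assumes F: "integrable lborel (cauchy_chain \<sigma> \<tau> j)" and s: "0 < \<sigma> j"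
    and eq: "\<forall>a>0. exp (- (\<sigma> j * a)) * sine_transform (cauchy_chain \<sigma> \<tau> j) a = pi * excursion_chain \<sigma> \<tau> j a"
  shows "cauchy_chain \<sigma> \<tau> (Suc j) u
    = exp (- (\<tau> (Suc j) * u\<^sup>2 / 2)) * indicator {0<..} u * (2 * sine_transform (excursion_chain \<sigma> \<tau> j) u)"
proof -
  have e: "exp (- (\<sigma> j * b)) * sin (u * b) * indicator {0<..} b * sine_transform (cauchy_chain \<sigma> \<tau> j) b
    = pi * (sin (u * b) * excursion_chain \<sigma> \<tau> j b)" for b
    using eq[rule_format, of b] by (cases "0 < b") (auto simp: excursion_chain_eq_0 algebra_simps)
  show ?thesis
    unfolding cauchy_chain.simps(2) integral_cauchy_kernel[OF F s] e
    unfolding sine_transform_def by simp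
qed

lemma abs_mult_left_mono: "\<bar>x\<bar> \<le> \<bar>y\<bar> \<Longrightarrow> \<bar>k * x\<bar> \<le> \<bar>k * y\<bar>" for k x y :: real
  unfolding abs_mult by (rule mult_left_mono) auto

text \<open>The heart of the matter. The sine transform carries one chain to the other, level by
  level: Gaussian weights become excursion kernels and Cauchy kernels become exponential
  weights. Integrability is carried along in the induction, since each level bounds the next
  one uniformly before the next weight is applied.\<close>

lemma chain_duality:
  assumes "\<And>i. i \<le> j \<Longrightarrow> 0 < \<sigma> i" "\<And>i. i \<le> j \<Longrightarrow> 0 < \<tau> i"
  shows "integrable lborel (cauchy_chain \<sigma> \<tau> j)"
    and "integrable lborel (excursion_chain \<sigma> \<tau> j)"
    and "\<And>a. 0 < a \<Longrightarrow> exp (- (\<sigma> j * a)) * sine_transform (cauchy_chain \<sigma> \<tau> j) a = pi * excursion_chain \<sigma> \<tau> j a"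
proof -
  have int_exc: "integrable lborel (excursion_chain \<sigma> \<tau> j)"
    if F: "integrable lborel (cauchy_chain \<sigma> \<tau> j)" and s: "0 < \<sigma> j"
      and eq: "\<And>a. 0 < a \<Longrightarrow> exp (- (\<sigma> j * a)) * sine_transform (cauchy_chain \<sigma> \<tau> j) a = pi * excursion_chain \<sigma> \<tau> j a"
    for j
  proof (rule Bochner_Integration.integrable_bound)
    define C where "C = (LINT u|lborel. \<bar>cauchy_chain \<sigma> \<tau> j u\<bar>)"
    show "integrable lborel (\<lambda>a. C / pi * (exp (- (\<sigma> j * a)) * indicator {0<..} a))"
      by (intro integrable_mult_right integrable_exp_decay s)
    have "\<bar>excursion_chain \<sigma> \<tau> j a\<bar> \<le> \<bar>C / pi * (exp (- (\<sigma> j * a)) * indicator {0<..} a)\<bar>" for a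
    proof (cases "0 < a")
      case True
      have "pi * \<bar>excursion_chain \<sigma> \<tau> j a\<bar> = \<bar>pi * excursion_chain \<sigma> \<tau> j a\<bar>"
        by (simp add: abs_mult)
      also have "\<dots> = exp (- (\<sigma> j * a)) * \<bar>sine_transform (cauchy_chain \<sigma> \<tau> j) a\<bar>"
        unfolding eq[OF True, symmetric] by (simp add: abs_mult)
      also have "\<dots> \<le> exp (- (\<sigma> j * a)) * C"
        unfolding C_def by (intro mult_left_mono abs_sine_transform_le F) simp
      finally have "\<bar>excursion_chain \<sigma> \<tau> j a\<bar> \<le> C / pi * exp (- (\<sigma> j * a))"
        by (simp add: field_simps)
      also have "\<dots> \<le> \<bar>C / pi * exp (- (\<sigma> j * a))\<bar>" by (rule abs_ge_self)
      finally show ?thesis using True by simp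
    qed (simp add: excursion_chain_eq_0)
    then show "AE a in lborel. norm (excursion_chain \<sigma> \<tau> j a) \<le> norm (C / pi * (exp (- (\<sigma> j * a)) * indicator {0<..} a))"
      by simp
  qed simp
  have "integrable lborel (cauchy_chain \<sigma> \<tau> j) \<and> integrable lborel (excursion_chain \<sigma> \<tau> j) \<and>
    (\<forall>a>0. exp (- (\<sigma> j * a)) * sine_transform (cauchy_chain \<sigma> \<tau> j) a = pi * excursion_chain \<sigma> \<tau> j a)"
    using assms
  proof (induction j)
    case 0
    then have t: "0 < \<tau> 0" and s: "0 < \<sigma> 0" by auto
    have e: "cauchy_chain \<sigma> \<tau> 0 = (\<lambda>u. u * exp (- (\<tau> 0 * u\<^sup>2 / 2)) * indicator {0<..} u)"
      by (simp add: fun_eq_iff)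
    have F: "integrable lborel (cauchy_chain \<sigma> \<tau> 0)"
      unfolding e by (rule integrable_gaussian_moment[OF t])
    have eq: "exp (- (\<sigma> 0 * a)) * sine_transform (cauchy_chain \<sigma> \<tau> 0) a = pi * excursion_chain \<sigma> \<tau> 0 a"
      if "0 < a" for a
      unfolding e sine_transform_gaussian_moment[OF t that] by simp
    from F eq int_exc[OF F s eq] show ?case by blast
  next
    case (Suc j)
    then have t: "0 < \<tau> (Suc j)" and s: "0 < \<sigma> (Suc j)" and s': "0 < \<sigma> j" by auto
    from Suc have F: "integrable lborel (cauchy_chain \<sigma> \<tau> j)" and E: "integrable lborel (excursion_chain \<sigma> \<tau> j)"
      and eq: "\<And>a. 0 < a \<Longrightarrow> exp (- (\<sigma> j * a)) * sine_transform (cauchy_chain \<sigma> \<tau> j) a = pi * excursion_chain \<sigma> \<tau> j a"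
      by auto
    have "\<forall>a>0. exp (- (\<sigma> j * a)) * sine_transform (cauchy_chain \<sigma> \<tau> j) a = pi * excursion_chain \<sigma> \<tau> j a" using eq by blast
    note step = cauchy_chain_Suc[OF F s' this]
    have g: "integrable lborel (\<lambda>u. exp (- (\<tau> (Suc j) * u\<^sup>2 / 2)) * indicator {0<..} u)"
      using integrable_cos_gaussian_half[OF t, of 0] by simp
    have F': "integrable lborel (cauchy_chain \<sigma> \<tau> (Suc j))"
    proof (rule Bochner_Integration.integrable_bound)
      define C where "C = (LINT u|lborel. \<bar>excursion_chain \<sigma> \<tau> j u\<bar>)"
      show "integrable lborel (\<lambda>u. exp (- (\<tau> (Suc j) * u\<^sup>2 / 2)) * indicator {0<..} u * (2 * C))"
        by (intro integrable_mult_left g)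
      have "\<bar>sine_transform (excursion_chain \<sigma> \<tau> j) u\<bar> \<le> \<bar>C\<bar>" for u
        using abs_sine_transform_le[OF E, of u] by (simp add: C_def)
      then show "AE u in lborel. norm (cauchy_chain \<sigma> \<tau> (Suc j) u)
          \<le> norm (exp (- (\<tau> (Suc j) * u\<^sup>2 / 2)) * indicator {0<..} u * (2 * C))"
        unfolding step real_norm_def by (intro AE_I2 abs_mult_left_mono)
    qed simp
    have eq': "exp (- (\<sigma> (Suc j) * a)) * sine_transform (cauchy_chain \<sigma> \<tau> (Suc j)) a = pi * excursion_chain \<sigma> \<tau> (Suc j) a"
      if a: "0 < a" for a
    proof -
      have int: "integrable lborel (\<lambda>v. sin (a * v) * exp (- (\<tau> (Suc j) * v\<^sup>2 / 2)) * indicator {0<..} v)"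
        using integrable_sin_mult[OF g, of a] by (simp add: mult.assoc)
      have "sine_transform (cauchy_chain \<sigma> \<tau> (Suc j)) a
        = 2 * (LINT v|lborel. (sin (a * v) * exp (- (\<tau> (Suc j) * v\<^sup>2 / 2)) * indicator {0<..} v) * sine_transform (excursion_chain \<sigma> \<tau> j) v)"
        unfolding sine_transform_def[of "cauchy_chain \<sigma> \<tau> (Suc j)"] step
        by (subst integral_mult_right_zero[symmetric]) (simp add: ac_simps)
      also have "\<dots> = 2 * (LINT b|lborel. pi / 2 * (exc_kernel (\<tau> (Suc j)) a b * excursion_chain \<sigma> \<tau> j b))"
        unfolding sine_transform_parseval[OF int E]
      proof (intro arg_cong[where f = "\<lambda>x. 2 * x"] Bochner_Integration.integral_cong refl)
        show "sine_transform (\<lambda>v. sin (a * v) * exp (- (\<tau> (Suc j) * v\<^sup>2 / 2)) * indicator {0<..} v) b * excursion_chain \<sigma> \<tau> j b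
          = pi / 2 * (exc_kernel (\<tau> (Suc j)) a b * excursion_chain \<sigma> \<tau> j b)" for b
          by (cases "0 < b") (simp_all add: sine_transform_gaussian[OF t a] excursion_chain_eq_0)
      qed
      also have "\<dots> = pi * (LINT b|lborel. exc_kernel (\<tau> (Suc j)) a b * excursion_chain \<sigma> \<tau> j b)"
        by (simp only: integral_mult_right_zero)
      finally show ?thesis by simp
    qed
    from F' eq' int_exc[OF F' s eq'] show ?case by blast
  qed
  then show "integrable lborel (cauchy_chain \<sigma> \<tau> j)"
    and "integrable lborel (excursion_chain \<sigma> \<tau> j)"
    and "\<And>a. 0 < a \<Longrightarrow> exp (- (\<sigma> j * a)) * sine_transform (cauchy_chain \<sigma> \<tau> j) a = pi * excursion_chain \<sigma> \<tau> j a"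
    by blast+
qed

text \<open>Closing the chain against \<open>u * exp (- r u\<^sup>2 / 2)\<close> yields a second entrance density, so the
  result is the Laplace functional of an excursion whose last time step is longer by \<open>r\<close>. The
  weight \<open>\<tau> (Suc j)\<close> may vanish as long as \<open>r\<close> is positive; this covers the case \<open>t 1 = 0\<close>.\<close>

lemma chain_duality_last:
  assumes pos: "\<And>i. i \<le> j \<Longrightarrow> 0 < \<sigma> i" "\<And>i. i \<le> j \<Longrightarrow> 0 < \<tau> i" and r: "0 < \<tau> (Suc j) + r"
  shows "(\<integral>\<^sup>+u. ennreal (u * exp (- (r * u\<^sup>2 / 2)) * cauchy_chain \<sigma> \<tau> (Suc j) u) \<partial>lborel)
    = ennreal (2 * pi) * (\<integral>\<^sup>+b. ennreal (exc_entrance (\<tau> (Suc j) + r) b * excursion_chain \<sigma> \<tau> j b) \<partial>lborel)"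
proof -
  have F: "integrable lborel (cauchy_chain \<sigma> \<tau> j)" and E: "integrable lborel (excursion_chain \<sigma> \<tau> j)"
    using pos by (auto intro: chain_duality)
  have eq: "\<forall>a>0. exp (- (\<sigma> j * a)) * sine_transform (cauchy_chain \<sigma> \<tau> j) a = pi * excursion_chain \<sigma> \<tau> j a" using pos by (auto intro: chain_duality)
  have s: "0 < \<sigma> j" using pos by simp
  define g where "g u = u * exp (- ((\<tau> (Suc j) + r) * u\<^sup>2 / 2)) * indicator {0<..} u" for u
  have g: "integrable lborel g" unfolding g_def by (rule integrable_gaussian_moment[OF r])
  have step: "u * exp (- (r * u\<^sup>2 / 2)) * cauchy_chain \<sigma> \<tau> (Suc j) u = 2 * (g u * sine_transform (excursion_chain \<sigma> \<tau> j) u)" for u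
  proof -
    have "exp (- ((\<tau> (Suc j) + r) * u\<^sup>2 / 2)) = exp (- (r * u\<^sup>2 / 2)) * exp (- (\<tau> (Suc j) * u\<^sup>2 / 2))"
      unfolding exp_add[symmetric] by (simp add: ring_distribs add_divide_distrib)
    then show ?thesis unfolding cauchy_chain_Suc[OF F s eq] g_def by (simp only: ac_simps)
  qed
  have g_int: "integrable lborel (\<lambda>u. g u * sine_transform (excursion_chain \<sigma> \<tau> j) u)"
  proof (rule Bochner_Integration.integrable_bound)
    define C where "C = (LINT u|lborel. \<bar>excursion_chain \<sigma> \<tau> j u\<bar>)"
    show "integrable lborel (\<lambda>u. g u * C)" by (intro integrable_mult_left g)
    have "\<bar>sine_transform (excursion_chain \<sigma> \<tau> j) u\<bar> \<le> \<bar>C\<bar>" for u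
      using abs_sine_transform_le[OF E, of u] by (simp add: C_def)
    then show "AE u in lborel. norm (g u * sine_transform (excursion_chain \<sigma> \<tau> j) u) \<le> norm (g u * C)"
      unfolding real_norm_def by (intro AE_I2 abs_mult_left_mono)
  qed (use g in \<open>auto dest: borel_measurable_integrable\<close>)
  have gt: "sine_transform g b * excursion_chain \<sigma> \<tau> j b = pi * (exc_entrance (\<tau> (Suc j) + r) b * excursion_chain \<sigma> \<tau> j b)" for b
    unfolding g_def
    by (cases "0 < b") (simp_all add: sine_transform_gaussian_moment[OF r] excursion_chain_eq_0)
  have gE_int: "integrable lborel (\<lambda>b. sine_transform g b * excursion_chain \<sigma> \<tau> j b)"
  proof (rule Bochner_Integration.integrable_bound)
    define C where "C = (LINT u|lborel. \<bar>g u\<bar>)"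
    show "integrable lborel (\<lambda>u. C * excursion_chain \<sigma> \<tau> j u)" by (intro integrable_mult_right E)
    have "\<bar>sine_transform g u\<bar> \<le> \<bar>C\<bar>" for u
      using abs_sine_transform_le[OF g, of u] by (simp add: C_def)
    then show "AE u in lborel. norm (sine_transform g u * excursion_chain \<sigma> \<tau> j u) \<le> norm (C * excursion_chain \<sigma> \<tau> j u)"
      unfolding real_norm_def mult.commute[of _ "excursion_chain \<sigma> \<tau> j _"] by (intro AE_I2 abs_mult_left_mono)
  qed (use g in \<open>auto dest: borel_measurable_integrable\<close>)
  have nn: "0 \<le> u * exp (- (r * u\<^sup>2 / 2)) * cauchy_chain \<sigma> \<tau> (Suc j) u" for u
    using pos by (cases "0 < u") (auto simp: cauchy_chain_eq_0 simp del: cauchy_chain.simps intro!: mult_nonneg_nonneg cauchy_chain_nonneg)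
  have nn': "0 \<le> exc_entrance (\<tau> (Suc j) + r) b * excursion_chain \<sigma> \<tau> j b" for b
    using pos r by (intro mult_nonneg_nonneg exc_entrance_nonneg excursion_chain_nonneg) auto
  have "(\<integral>\<^sup>+u. ennreal (u * exp (- (r * u\<^sup>2 / 2)) * cauchy_chain \<sigma> \<tau> (Suc j) u) \<partial>lborel)
    = ennreal (LINT u|lborel. 2 * (g u * sine_transform (excursion_chain \<sigma> \<tau> j) u))"
    using nn unfolding step by (intro nn_integral_eq_integral integrable_mult_right g_int) simp
  also have "(LINT u|lborel. 2 * (g u * sine_transform (excursion_chain \<sigma> \<tau> j) u))
      = 2 * pi * (LINT b|lborel. exc_entrance (\<tau> (Suc j) + r) b * excursion_chain \<sigma> \<tau> j b)"
    by (simp add: sine_transform_parseval[OF g E] gt)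
  also have "ennreal \<dots> = ennreal (2 * pi) * ennreal (LINT b|lborel. exc_entrance (\<tau> (Suc j) + r) b * excursion_chain \<sigma> \<tau> j b)"
    using nn' by (intro ennreal_mult integral_nonneg_AE) auto
  also have "ennreal (LINT b|lborel. exc_entrance (\<tau> (Suc j) + r) b * excursion_chain \<sigma> \<tau> j b)
      = (\<integral>\<^sup>+b. ennreal (exc_entrance (\<tau> (Suc j) + r) b * excursion_chain \<sigma> \<tau> j b) \<partial>lborel)"
    using gE_int nn' unfolding gt by (intro nn_integral_eq_integral[symmetric]) auto
  finally show ?thesis .
qed

section \<open>Change of variables and the Gamma integral\<close>

text \<open>The change of variables theorem for the gauge integral is an equivalence between finite
  values. For a nonnegative integrand this covers infinite values as well: if either side
  is finite, so is the other.\<close>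

lemma nn_integral_change_of_variables_indicator:
  fixes g g' :: "real \<Rightarrow> real"
  assumes S: "S \<in> sets borel" "g ` S \<in> sets borel" and A: "A \<in> sets borel"
    and meas [measurable]: "g \<in> borel_measurable borel" "g' \<in> borel_measurable borel"
    and deriv: "\<And>x. x \<in> S \<Longrightarrow> (g has_real_derivative g' x) (at x)" and inj: "inj_on g S"
  shows "(\<integral>\<^sup>+x. ennreal (indicator (g ` S) x * indicator A x) \<partial>lborel)
    = (\<integral>\<^sup>+x. ennreal (indicator S x * (\<bar>g' x\<bar> * indicator A (g x))) \<partial>lborel)"
    (is "?I = ?J")
proof -
  note [measurable] = S A
  let ?f = "indicator A :: real \<Rightarrow> real"
  have cov: "(\<lambda>x. \<bar>g' x\<bar> * ?f (g x)) absolutely_integrable_on S \<and> integral S (\<lambda>x. \<bar>g' x\<bar> * ?f (g x)) = b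
      \<longleftrightarrow> ?f absolutely_integrable_on (g ` S) \<and> integral (g ` S) ?f = b" for b
    by (rule has_absolute_integral_change_of_variables_1')
       (use S deriv inj in \<open>auto intro: has_field_derivative_at_within\<close>)
  have fin: "h absolutely_integrable_on T" if "T \<in> sets borel" "h \<in> borel_measurable borel" "\<And>x. 0 \<le> h x"
    "(\<integral>\<^sup>+x. ennreal (indicator T x * h x) \<partial>lborel) < \<infinity>" for h :: "real \<Rightarrow> real" and T
  proof -
    have "integrable lborel (\<lambda>x. indicator T x * h x)"
      by (rule integrableI_nonneg) (use that in auto)
    then show ?thesis
      unfolding set_integrable_def by (simp add: integrable_completion that)
  qed
  have val: "(\<integral>\<^sup>+x. ennreal (indicator T x * h x) \<partial>lborel) = ennreal (integral T h)"
    if "h absolutely_integrable_on T" "\<And>x. 0 \<le> h x" for h :: "real \<Rightarrow> real" and T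
    by (rule nn_integral_has_integral_lebesgue)
       (use that in \<open>auto intro: integrable_integral set_lebesgue_integral_eq_integral\<close>)
  \<comment> \<open>An infinite integral is not seen by \<open>cov\<close>, but then the other one is infinite as well.\<close>
  consider "?I < \<infinity>" | "?J < \<infinity>" | "?I = \<infinity>" "?J = \<infinity>" by (metis infinity_ennreal_def top.not_eq_extremum)
  then show ?thesis
  proof cases
    case 1
    then have "?f absolutely_integrable_on (g ` S)" by (intro fin) auto
    with cov[of "integral (g ` S) ?f"] show ?thesis by (simp add: val)
  next
    case 2
    then have "(\<lambda>x. \<bar>g' x\<bar> * ?f (g x)) absolutely_integrable_on S" by (intro fin) auto
    with cov[of "integral S (\<lambda>x. \<bar>g' x\<bar> * ?f (g x))"] show ?thesis by (simp add: val)
  qed simp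
qed

lemma nn_integral_change_of_variables:
  fixes g g' :: "real \<Rightarrow> real" and f :: "real \<Rightarrow> ennreal"
  assumes S: "S \<in> sets borel" "g ` S \<in> sets borel"
    and meas [measurable]: "g \<in> borel_measurable borel" "g' \<in> borel_measurable borel" "f \<in> borel_measurable borel"
    and deriv: "\<And>x. x \<in> S \<Longrightarrow> (g has_real_derivative g' x) (at x)" and inj: "inj_on g S"
  shows "(\<integral>\<^sup>+x. indicator (g ` S) x * f x \<partial>lborel)
    = (\<integral>\<^sup>+x. indicator S x * (ennreal \<bar>g' x\<bar> * f (g x)) \<partial>lborel)"
proof -
  note [measurable] = S
  let ?\<mu> = "distr (density lborel (\<lambda>x. indicator S x * ennreal \<bar>g' x\<bar>)) borel g"
  have eq: "density lborel (indicator (g ` S)) = ?\<mu>"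
  proof (rule measure_eqI)
    fix A assume "A \<in> sets (density lborel (indicator (g ` S)))"
    then have A [measurable]: "A \<in> sets borel" by simp
    have "emeasure (density lborel (indicator (g ` S))) A
        = (\<integral>\<^sup>+x. ennreal (indicator (g ` S) x * indicator A x) \<partial>lborel)"
      by (simp add: emeasure_density ennreal_mult ennreal_indicator)
    also have "\<dots> = (\<integral>\<^sup>+x. ennreal (indicator S x * (\<bar>g' x\<bar> * indicator A (g x))) \<partial>lborel)"
      by (rule nn_integral_change_of_variables_indicator[OF S A meas(1,2) deriv inj])
    also have "\<dots> = emeasure ?\<mu> A"
    proof -
      have [measurable]: "g -` A \<in> sets borel" using measurable_sets[OF meas(1) A] by simp
      have "emeasure ?\<mu> A = (\<integral>\<^sup>+x. indicator S x * ennreal \<bar>g' x\<bar> * indicator (g -` A) x \<partial>lborel)"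
        by (simp add: emeasure_distr emeasure_density)
      also have "\<dots> = (\<integral>\<^sup>+x. ennreal (indicator S x * (\<bar>g' x\<bar> * indicator A (g x))) \<partial>lborel)"
        by (intro nn_integral_cong) (simp add: indicator_def)
      finally show ?thesis ..
    qed
    finally show "emeasure (density lborel (indicator (g ` S))) A = emeasure ?\<mu> A" .
  qed simp
  have "(\<integral>\<^sup>+x. indicator (g ` S) x * f x \<partial>lborel) = integral\<^sup>N (density lborel (indicator (g ` S))) f"
    by (simp add: nn_integral_density)
  also have "\<dots> = (\<integral>\<^sup>+x. indicator S x * (ennreal \<bar>g' x\<bar> * f (g x)) \<partial>lborel)"
    unfolding eq by (simp add: nn_integral_distr nn_integral_density mult.assoc)
  finally show ?thesis .
qed

lemma nn_integral_substitute_square: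
  assumes [measurable]: "f \<in> borel_measurable borel"
  shows "(\<integral>\<^sup>+x. indicator {0<..} x * f x \<partial>lborel)
    = (\<integral>\<^sup>+u. indicator {0<..} u * (ennreal (2 * u) * f (u\<^sup>2)) \<partial>lborel)"
proof -
  have im: "(\<lambda>u::real. u\<^sup>2) ` {0<..} = {0<..}"
  proof (intro equalityI subsetI)
    fix x :: real assume "x \<in> {0<..}"
    then have "x = (sqrt x)\<^sup>2" "sqrt x \<in> {0<..}" by auto
    then show "x \<in> (\<lambda>u::real. u\<^sup>2) ` {0<..}" by (rule image_eqI)
  qed auto
  have "(\<integral>\<^sup>+x. indicator ((\<lambda>u::real. u\<^sup>2) ` {0<..}) x * f x \<partial>lborel)
    = (\<integral>\<^sup>+u. indicator {0<..} u * (ennreal \<bar>2 * u\<bar> * f (u\<^sup>2)) \<partial>lborel)"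
    by (rule nn_integral_change_of_variables)
       (auto simp: im inj_on_def power2_eq_iff intro!: derivative_eq_intros)
  then show ?thesis
    unfolding im by (simp only:) (auto intro!: nn_integral_cong simp: indicator_def)
qed

lemma nn_integral_substitute_inverse:
  assumes [measurable]: "f \<in> borel_measurable borel"
  shows "(\<integral>\<^sup>+v. indicator {0<..<1} v * f v \<partial>lborel)
    = (\<integral>\<^sup>+r. indicator {0<..} r * (ennreal (1 / (1 + r)\<^sup>2) * f (1 / (1 + r))) \<partial>lborel)"
proof -
  have im: "(\<lambda>r::real. 1 / (1 + r)) ` {0<..} = {0<..<1}"
  proof (intro equalityI subsetI)
    fix x :: real assume "x \<in> {0<..<1}"
    then have "x = 1 / (1 + (1 / x - 1))" "1 / x - 1 \<in> {0<..}" by auto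
    then show "x \<in> (\<lambda>r::real. 1 / (1 + r)) ` {0<..}" by (rule image_eqI)
  qed auto
  have "(\<integral>\<^sup>+x. indicator ((\<lambda>r::real. 1 / (1 + r)) ` {0<..}) x * f x \<partial>lborel)
    = (\<integral>\<^sup>+u. indicator {0<..} u * (ennreal \<bar>- 1 / (1 + u)\<^sup>2\<bar> * f (1 / (1 + u))) \<partial>lborel)"
    by (rule nn_integral_change_of_variables)
       (auto simp: im inj_on_def power2_eq_square intro!: derivative_eq_intros)
  then show ?thesis
    unfolding im by simp
qed

text \<open>The Gamma integral with a rate: Gaussians \<open>exp (- r u\<^sup>2 / 2)\<close> will be averaged over \<open>r\<close>
  by means of it.\<close>

lemma nn_integral_gamma_rate:
  assumes s: "0 < s" and c: "(0::real) < c"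
  shows "(\<integral>\<^sup>+r. ennreal (indicator {0<..} r * (r powr (s - 1) * exp (- (c * r)))) \<partial>lborel) = ennreal (Gamma s / c powr s)"
proof -
  have "ennreal (Gamma s) = (\<integral>\<^sup>+t. ennreal (indicator {0..} t * t powr (s - 1) / exp t) \<partial>lborel)"
    by (rule Gamma_conv_nn_integral_real[OF s])
  also have "\<dots> = ennreal c * (\<integral>\<^sup>+r. ennreal (indicator {0..} (0 + c * r) * (0 + c * r) powr (s - 1) / exp (0 + c * r)) \<partial>lborel)"
    using nn_integral_real_affine[of "\<lambda>t. ennreal (indicator {0..} t * t powr (s - 1) / exp t)" c 0] c by simp
  also have "\<dots> = ennreal c * (\<integral>\<^sup>+r. ennreal (c powr (s - 1)) * ennreal (indicator {0<..} r * (r powr (s - 1) * exp (- (c * r)))) \<partial>lborel)"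
    using c by (intro arg_cong[where f = "\<lambda>x. ennreal c * x"] nn_integral_cong)
      (auto simp: indicator_def powr_mult exp_minus field_simps zero_le_mult_iff simp flip: ennreal_mult)
  also have "\<dots> = ennreal (c powr s) * (\<integral>\<^sup>+r. ennreal (indicator {0<..} r * (r powr (s - 1) * exp (- (c * r)))) \<partial>lborel)"
    using c by (subst nn_integral_cmult)
      (auto simp: mult.assoc[symmetric] powr_mult_base simp flip: ennreal_mult)
  finally have G: "ennreal (Gamma s) = ennreal (c powr s) *
      (\<integral>\<^sup>+r. ennreal (indicator {0<..} r * (r powr (s - 1) * exp (- (c * r)))) \<partial>lborel)" .
  have "ennreal (Gamma s / c powr s) = ennreal (1 / c powr s) * ennreal (Gamma s)"
    using c Gamma_real_pos[OF s] by (subst ennreal_mult[symmetric]) auto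
  moreover have "ennreal (1 / c powr s) * (ennreal (c powr s) * I) = I" for I
    using c by (simp add: mult.assoc[symmetric] ennreal_mult[symmetric])
  ultimately show ?thesis unfolding G by simp
qed

section \<open>The Markov process in square-root coordinates\<close>

lemma measurable_history:
  assumes "\<And>u. u \<in> {0..s} \<Longrightarrow> X u \<in> borel_measurable N" and "u \<in> {0..s}"
  shows "X u \<in> borel_measurable (history N X s)"
proof -
  have "(\<lambda>\<omega>. \<lambda>u\<in>{0..s}. X u \<omega>) \<in> measurable (history N X s) (\<Pi>\<^sub>M u\<in>{0..s}. borel)"
    unfolding history_def by (rule measurable_vimage_algebra1) (auto simp: space_PiM)
  from measurable_compose[OF this measurable_component_singleton[OF assms(2)]] assms(2)
  show ?thesis by simp
qed

lemma subalgebra_history: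
  assumes "\<And>u. u \<in> {0..s} \<Longrightarrow> X u \<in> borel_measurable N"
  shows "subalgebra N (history N X s)"
  unfolding subalgebra_def
proof
  show "space (history N X s) = space N" by (simp add: history_def)
  have "(\<lambda>\<omega>. \<lambda>u\<in>{0..s}. X u \<omega>) \<in> measurable N (\<Pi>\<^sub>M u\<in>{0..s}. borel)"
    by (rule measurable_restrict) (use assms in auto)
  then show "sets (history N X s) \<subseteq> sets N"
    unfolding history_def by (rule sets_image_in_sets[OF refl])
qed

lemma markov_process_fromD:
  assumes "markov_process_from p N X x"
  shows "prob_space N" "AE \<omega> in N. X 0 \<omega> = x"
    and "\<And>t. 0 \<le> t \<Longrightarrow> X t \<in> borel_measurable N"
    and "\<And>t \<omega>. 0 \<le> t \<Longrightarrow> \<omega> \<in> space N \<Longrightarrow> 0 \<le> X t \<omega>"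
  using assms unfolding markov_process_from_def by blast+

context
  fixes p :: "real \<Rightarrow> real \<Rightarrow> real \<Rightarrow> real" and N :: "'b measure" and X :: "real \<Rightarrow> 'b \<Rightarrow> real" and x0 s t :: real
  assumes markov: "markov_process_from p N X x0"
    and st: "0 \<le> s" "s < t"
    and p_meas [measurable]: "(\<lambda>(x, y). p (t - s) x y) \<in> borel_measurable (borel \<Otimes>\<^sub>M borel)"
    and p_nonneg: "\<And>x y. 0 \<le> x \<Longrightarrow> 0 \<le> y \<Longrightarrow> 0 \<le> p (t - s) x y"
begin

interpretation prob_space N using markov by (simp add: markov_process_from_def)

interpretation finite_measure_subalgebra N "history N X s"
  by unfold_locales (rule subalgebra_history, rule markov_process_fromD(3)[OF markov], simp)

lemma markov_cond_exp_indicator: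
  assumes "A \<in> sets borel"
  shows "AE \<omega> in N. real_cond_exp N (history N X s) (indicator (X t -` A \<inter> space N)) \<omega>
                   = (LBINT y:A \<inter> {0..}. p (t - s) (X s \<omega>) y)"
  using markov st assms by (simp add: markov_process_from_def)

text \<open>Conditioning the sure event shows that the kernel integrates to \<open>1\<close>. As the integral of a
  function that is not integrable is \<open>0\<close> by convention, integrability follows.\<close>

lemma markov_kernel_integrable:
  "AE \<omega> in N. integrable lborel (\<lambda>y. indicator {0..} y * p (t - s) (X s \<omega>) y)"
proof -
  have "AE \<omega> in N. real_cond_exp N (history N X s) (\<lambda>_. 1) \<omega> = 1"
    by (rule real_cond_exp_F_meas) auto
  moreover have "AE \<omega> in N. real_cond_exp N (history N X s) (indicator (X t -` UNIV \<inter> space N)) \<omega>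
      = real_cond_exp N (history N X s) (\<lambda>_. 1) \<omega>"
    using st by (intro real_cond_exp_cong) auto
  moreover have "AE \<omega> in N. real_cond_exp N (history N X s) (indicator (X t -` UNIV \<inter> space N)) \<omega>
      = (LBINT y:{0..}. p (t - s) (X s \<omega>) y)"
    using markov_cond_exp_indicator[of UNIV] by simp
  ultimately have "AE \<omega> in N. (LBINT y:{0..}. p (t - s) (X s \<omega>) y) = 1"
    by eventually_elim simp
  then show ?thesis
  proof eventually_elim
    case (elim \<omega>)
    show ?case
    proof (rule ccontr)
      assume "\<not> integrable lborel (\<lambda>y. indicator {0..} y * p (t - s) (X s \<omega>) y)"
      then show False
        using elim by (simp add: set_lebesgue_integral_def not_integrable_integral_eq)
    qed
  qed
qed

text \<open>The defining property of the process concerns indicators and the Bochner integral; for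
  iteration it is put into the form of nonnegative integrals, with a weight \<open>Z\<close> that depends
  on the past and an arbitrary nonnegative function \<open>h\<close> of the state at the later time.\<close>

lemma markov_step:
  assumes h: "h \<in> borel_measurable borel"
    and Z [measurable]: "Z \<in> borel_measurable (history N X s)" and Z01: "\<And>\<omega>. 0 \<le> Z \<omega> \<and> Z \<omega> \<le> 1"
  shows "(\<integral>\<^sup>+\<omega>. ennreal (Z \<omega>) * h (X t \<omega>) \<partial>N)
    = (\<integral>\<^sup>+\<omega>. ennreal (Z \<omega>) *
         (\<integral>\<^sup>+y. indicator {0..} y * ennreal (p (t - s) (X s \<omega>) y) * h y \<partial>lborel) \<partial>N)"
  using h
proof (induction h rule: borel_measurable_induct)
  case (cong f g)
  then show ?case by simp
next
  case (set A)
  have t0: "0 \<le> t" using st by simp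
  have [measurable]: "Z \<in> borel_measurable N" by (rule measurable_from_subalg[OF subalg Z])
  have [measurable]: "X t \<in> borel_measurable N" "X s \<in> borel_measurable N" using st by (auto intro: markov_process_fromD(3)[OF markov])
  have [measurable]: "A \<in> sets borel" using set .
  let ?g = "indicator (X t -` A \<inter> space N) :: 'b \<Rightarrow> real"
  let ?c = "\<lambda>\<omega>. LBINT y:A \<inter> {0..}. p (t - s) (X s \<omega>) y"
  have int: "integrable N (\<lambda>\<omega>. Z \<omega> * ?g \<omega>)"
    by (rule integrable_const_bound[of _ 1])
       (use Z01 in \<open>auto intro!: AE_I2 simp: indicator_def\<close>)
  note ce = real_cond_exp_intg[OF int Z, simplified]
  have c_eq: "AE \<omega> in N. ennreal (?c \<omega>)
      = (\<integral>\<^sup>+y. indicator {0..} y * ennreal (p (t - s) (X s \<omega>) y) * indicator A y \<partial>lborel)"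
    using markov_kernel_integrable AE_space
  proof eventually_elim
    case (elim \<omega>)
    have x: "0 \<le> X s \<omega>" using elim st by (intro markov_process_fromD(4)[OF markov])
    have "ennreal (?c \<omega>) = (\<integral>\<^sup>+y. ennreal (indicator (A \<inter> {0..}) y * p (t - s) (X s \<omega>) y) \<partial>lborel)"
      unfolding set_lebesgue_integral_def real_scaleR_def
    proof (rule nn_integral_eq_integral[symmetric])
      show "integrable lborel (\<lambda>y. indicator (A \<inter> {0..}) y * p (t - s) (X s \<omega>) y)"
        by (rule Bochner_Integration.integrable_bound[OF elim(1)])
           (auto simp: indicator_def intro!: AE_I2)
    qed (use x p_nonneg in \<open>auto simp: indicator_def\<close>)
    also have "\<dots> = (\<integral>\<^sup>+y. indicator {0..} y * ennreal (p (t - s) (X s \<omega>) y) * indicator A y \<partial>lborel)"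
      by (intro nn_integral_cong) (auto simp: indicator_def)
    finally show ?case .
  qed
  have "(\<integral>\<^sup>+\<omega>. ennreal (Z \<omega>) * indicator A (X t \<omega>) \<partial>N) = (\<integral>\<^sup>+\<omega>. ennreal (Z \<omega> * ?g \<omega>) \<partial>N)"
    by (intro nn_integral_cong) (auto simp: indicator_def)
  also have "\<dots> = ennreal (\<integral>\<omega>. Z \<omega> * ?g \<omega> \<partial>N)"
    using Z01 by (intro nn_integral_eq_integral int) (auto intro!: AE_I2)
  also have "\<dots> = ennreal (\<integral>\<omega>. Z \<omega> * real_cond_exp N (history N X s) ?g \<omega> \<partial>N)"
    using ce by simp
  also have "\<dots> = (\<integral>\<^sup>+\<omega>. ennreal (Z \<omega> * real_cond_exp N (history N X s) ?g \<omega>) \<partial>N)"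
  proof (rule nn_integral_eq_integral[symmetric])
    have "AE \<omega> in N. 0 \<le> real_cond_exp N (history N X s) ?g \<omega>"
      by (rule real_cond_exp_pos) auto
    then show "AE \<omega> in N. 0 \<le> Z \<omega> * real_cond_exp N (history N X s) ?g \<omega>"
      using Z01 by (auto elim!: AE_mp)
  qed (use ce in simp)
  also have "\<dots> = (\<integral>\<^sup>+\<omega>. ennreal (Z \<omega>) * ennreal (?c \<omega>) \<partial>N)"
    using markov_cond_exp_indicator[OF set] Z01
    by (intro nn_integral_cong_AE) (auto elim!: AE_mp simp: ennreal_mult')
  also have "\<dots> = (\<integral>\<^sup>+\<omega>. ennreal (Z \<omega>) *
         (\<integral>\<^sup>+y. indicator {0..} y * ennreal (p (t - s) (X s \<omega>) y) * indicator A y \<partial>lborel) \<partial>N)"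
    using c_eq by (intro nn_integral_cong_AE) (auto elim!: AE_mp)
  finally show ?case .
next
  case (mult u c)
  have [measurable]: "Z \<in> borel_measurable N" by (rule measurable_from_subalg[OF subalg Z])
  have [measurable]: "X t \<in> borel_measurable N" "X s \<in> borel_measurable N" "u \<in> borel_measurable borel"
    using st mult by (auto intro: markov_process_fromD(3)[OF markov])
  have "(\<integral>\<^sup>+\<omega>. ennreal (Z \<omega>) * (c * u (X t \<omega>)) \<partial>N) = c * (\<integral>\<^sup>+\<omega>. ennreal (Z \<omega>) * u (X t \<omega>) \<partial>N)"
    by (subst nn_integral_cmult[symmetric]) (auto simp: ac_simps)
  also have "\<dots> = (\<integral>\<^sup>+\<omega>. c * (ennreal (Z \<omega>) *
         (\<integral>\<^sup>+y. indicator {0..} y * ennreal (p (t - s) (X s \<omega>) y) * u y \<partial>lborel)) \<partial>N)"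
    unfolding mult.IH by (subst nn_integral_cmult) auto
  also have "\<dots> = (\<integral>\<^sup>+\<omega>. ennreal (Z \<omega>) *
         (\<integral>\<^sup>+y. indicator {0..} y * ennreal (p (t - s) (X s \<omega>) y) * (c * u y) \<partial>lborel) \<partial>N)"
  proof (rule nn_integral_cong)
    fix \<omega>
    have "(\<integral>\<^sup>+y. indicator {0..} y * ennreal (p (t - s) (X s \<omega>) y) * (c * u y) \<partial>lborel)
      = (\<integral>\<^sup>+y. c * (indicator {0..} y * ennreal (p (t - s) (X s \<omega>) y) * u y) \<partial>lborel)"
      by (simp add: ac_simps)
    also have "\<dots> = c * (\<integral>\<^sup>+y. indicator {0..} y * ennreal (p (t - s) (X s \<omega>) y) * u y \<partial>lborel)"
      by (rule nn_integral_cmult) measurable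
    finally show "c * (ennreal (Z \<omega>) * (\<integral>\<^sup>+y. indicator {0..} y * ennreal (p (t - s) (X s \<omega>) y) * u y \<partial>lborel))
      = ennreal (Z \<omega>) * (\<integral>\<^sup>+y. indicator {0..} y * ennreal (p (t - s) (X s \<omega>) y) * (c * u y) \<partial>lborel)"
      by (simp add: ac_simps)
  qed
  finally show ?case .
next
  case (add u v)
  have [measurable]: "Z \<in> borel_measurable N" by (rule measurable_from_subalg[OF subalg Z])
  have [measurable]: "X t \<in> borel_measurable N" "X s \<in> borel_measurable N"
    "u \<in> borel_measurable borel" "v \<in> borel_measurable borel"
    using st add by (auto intro: markov_process_fromD(3)[OF markov])
  show ?case
    by (simp add: distrib_left nn_integral_add add.IH)
next
  case (seq U)
  have [measurable]: "Z \<in> borel_measurable N" by (rule measurable_from_subalg[OF subalg Z])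
  have [measurable]: "X t \<in> borel_measurable N" "X s \<in> borel_measurable N"
    using st by (auto intro: markov_process_fromD(3)[OF markov])
  have U [measurable]: "\<And>i. U i \<in> borel_measurable borel" using seq by simp
  have inc: "incseq (\<lambda>i \<omega>. c \<omega> * U i (f \<omega>))" for c :: "'c \<Rightarrow> ennreal" and f
    using \<open>incseq U\<close> by (auto simp: incseq_def le_fun_def intro!: mult_left_mono)
  let ?k = "\<lambda>u \<omega>. \<integral>\<^sup>+y. indicator {0..} y * ennreal (p (t - s) (X s \<omega>) y) * u y \<partial>lborel"
  have k_sup: "?k (SUP i. U i) \<omega> = (SUP i. ?k (U i) \<omega>)" for \<omega>
    unfolding SUP_apply SUP_mult_left_ennreal
    by (rule nn_integral_monotone_convergence_SUP[OF inc]) measurable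
  have "(\<integral>\<^sup>+\<omega>. ennreal (Z \<omega>) * (SUP i. U i) (X t \<omega>) \<partial>N) = (SUP i. \<integral>\<^sup>+\<omega>. ennreal (Z \<omega>) * U i (X t \<omega>) \<partial>N)"
    unfolding SUP_apply SUP_mult_left_ennreal
    by (rule nn_integral_monotone_convergence_SUP[OF inc]) measurable
  also have "\<dots> = (SUP i. \<integral>\<^sup>+\<omega>. ennreal (Z \<omega>) * ?k (U i) \<omega> \<partial>N)"
    using seq by simp
  also have "\<dots> = (\<integral>\<^sup>+\<omega>. ennreal (Z \<omega>) * ?k (SUP i. U i) \<omega> \<partial>N)"
    unfolding k_sup SUP_mult_left_ennreal
  proof (rule nn_integral_monotone_convergence_SUP[symmetric])
    have "incseq (\<lambda>i. ?k (U i) \<omega>)" for \<omega>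
      using \<open>incseq U\<close> by (auto simp: incseq_def le_fun_def intro!: nn_integral_mono mult_left_mono)
    then show "incseq (\<lambda>i \<omega>. ennreal (Z \<omega>) * ?k (U i) \<omega>)"
      by (auto simp: incseq_def le_fun_def intro!: mult_left_mono)
  qed measurable
  finally show ?case .
qed

end

text \<open>Iterating the Markov property from the last time down to time \<open>0\<close>. The functions \<open>W k\<close> are the
  conditional expectations of the factors from index \<open>k\<close> on, given the state at time \<open>s k\<close>.\<close>

lemma markov_process_nn_integral_prod:
  fixes \<phi> :: "nat \<Rightarrow> real \<Rightarrow> real" and W :: "nat \<Rightarrow> real \<Rightarrow> ennreal"
  assumes markov: "markov_process_from p N X x"
    and s: "s 0 = 0" "strict_mono_on {0..d} s"
    and p_meas: "\<And>t. (\<lambda>(x, y). p t x y) \<in> borel_measurable (borel \<Otimes>\<^sub>M borel)"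
    and p_nonneg: "\<And>t x y. 0 < t \<Longrightarrow> 0 \<le> x \<Longrightarrow> 0 \<le> y \<Longrightarrow> 0 \<le> p t x y"
    and \<phi>_meas: "\<And>k. \<phi> k \<in> borel_measurable borel"
    and \<phi>: "\<And>k y. 0 \<le> \<phi> k y" "\<And>k y. k \<le> d \<Longrightarrow> 0 \<le> y \<Longrightarrow> \<phi> k y \<le> 1"
    and W_meas: "\<And>k. W k \<in> borel_measurable borel"
    and W_last: "\<And>y. W d y = ennreal (\<phi> d y)"
    and W_step: "\<And>k y. k < d \<Longrightarrow> W k y = ennreal (\<phi> k y) *
        (\<integral>\<^sup>+z. indicator {0..} z * ennreal (p (s (Suc k) - s k) y z) * W (Suc k) z \<partial>lborel)"
  shows "(\<integral>\<^sup>+\<omega>. ennreal (\<Prod>k\<le>d. \<phi> k (X (s k) \<omega>)) \<partial>N) = W 0 x"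
proof -
  note X = markov_process_fromD(3)[OF markov] and X0 = markov_process_fromD(4)[OF markov]
  interpret prob_space N by (rule markov_process_fromD(1)[OF markov])
  have s_mono: "s i \<le> s j" if "i \<le> j" "j \<le> d" for i j
    by (rule strict_mono_on_leD[OF s(2)]) (use that in auto)
  have s0: "0 \<le> s j" if "j \<le> d" for j using s_mono[of 0 j] that s(1) by simp
  have "(\<integral>\<^sup>+\<omega>. ennreal (\<Prod>k<n. \<phi> k (X (s k) \<omega>)) * W n (X (s n) \<omega>) \<partial>N) = W 0 x" if "n \<le> d" for n
    using that
  proof (induction n)
    case 0
    have "(\<integral>\<^sup>+\<omega>. W 0 (X 0 \<omega>) \<partial>N) = (\<integral>\<^sup>+\<omega>. W 0 x \<partial>N)"
    proof (rule nn_integral_cong_AE)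
      from markov_process_fromD(2)[OF markov]
      show "AE \<omega> in N. W 0 (X 0 \<omega>) = W 0 x" by eventually_elim simp
    qed
    then show ?case by (simp add: s emeasure_space_1)
  next
    case (Suc n)
    \<comment> \<open>The clamping changes nothing on the space; it provides the bounds at all points of the type.\<close>
    define Z where "Z \<omega> = max 0 (min 1 (\<Prod>k<Suc n. \<phi> k (X (s k) \<omega>)))" for \<omega>
    have Z: "(\<Prod>k<Suc n. \<phi> k (X (s k) \<omega>)) = Z \<omega>" if "\<omega> \<in> space N" for \<omega>
    proof -
      have "(\<Prod>k<Suc n. \<phi> k (X (s k) \<omega>)) \<le> 1"
        using Suc.prems that by (intro prod_le_1 conjI \<phi> X0 s0) auto
      moreover have "0 \<le> (\<Prod>k<Suc n. \<phi> k (X (s k) \<omega>))"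
        by (intro prod_nonneg ballI \<phi>)
      ultimately show ?thesis by (simp add: Z_def)
    qed
    have "X (s k) \<in> borel_measurable (history N X (s n))" if "k < Suc n" for k
      using that Suc.prems by (intro measurable_history) (auto intro: X s0 s_mono)
    then have "(\<lambda>\<omega>. \<phi> k (X (s k) \<omega>)) \<in> borel_measurable (history N X (s n))" if "k < Suc n" for k
      using that by (intro measurable_compose[OF _ \<phi>_meas])
    then have Z_meas: "Z \<in> borel_measurable (history N X (s n))"
      unfolding Z_def
      by (intro borel_measurable_max borel_measurable_min borel_measurable_const borel_measurable_prod) simp
    have "(\<integral>\<^sup>+\<omega>. ennreal (\<Prod>k<Suc n. \<phi> k (X (s k) \<omega>)) * W (Suc n) (X (s (Suc n)) \<omega>) \<partial>N)
      = (\<integral>\<^sup>+\<omega>. ennreal (Z \<omega>) * W (Suc n) (X (s (Suc n)) \<omega>) \<partial>N)"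
      by (intro nn_integral_cong) (simp add: Z del: prod.lessThan_Suc)
    also have "\<dots> = (\<integral>\<^sup>+\<omega>. ennreal (Z \<omega>) * (\<integral>\<^sup>+z. indicator {0..} z *
          ennreal (p (s (Suc n) - s n) (X (s n) \<omega>) z) * W (Suc n) z \<partial>lborel) \<partial>N)"
    proof (rule markov_step[where s = "s n" and t = "s (Suc n)" and h = "W (Suc n)" and Z = Z, OF markov])
      show "0 \<le> s n" "s n < s (Suc n)"
        using Suc.prems s0 strict_mono_onD[OF s(2), of n "Suc n"] by auto
      then show "\<And>x y. 0 \<le> x \<Longrightarrow> 0 \<le> y \<Longrightarrow> 0 \<le> p (s (Suc n) - s n) x y"
        by (intro p_nonneg) auto
      show "\<And>\<omega>. 0 \<le> Z \<omega> \<and> Z \<omega> \<le> 1" by (auto simp: Z_def)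
    qed (fact p_meas W_meas Z_meas)+
    also have "\<dots> = (\<integral>\<^sup>+\<omega>. ennreal (\<Prod>k<n. \<phi> k (X (s k) \<omega>)) * W n (X (s n) \<omega>) \<partial>N)"
      using Suc.prems
      by (intro nn_integral_cong)
         (simp add: W_step \<phi> prod_nonneg ennreal_mult mult.assoc Z[symmetric])
    also have "\<dots> = W 0 x" using Suc by simp
    finally show ?case .
  qed
  from this[of d] have "W 0 x = (\<integral>\<^sup>+\<omega>. ennreal (\<Prod>k<d. \<phi> k (X (s k) \<omega>)) * ennreal (\<phi> d (X (s d) \<omega>)) \<partial>N)"
    by (simp add: W_last)
  also have "\<dots> = (\<integral>\<^sup>+\<omega>. ennreal (\<Prod>k\<le>d. \<phi> k (X (s k) \<omega>)) \<partial>N)"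
    by (simp add: lessThan_Suc_atMost[symmetric] \<phi> prod_nonneg flip: ennreal_mult)
  finally show ?thesis ..
qed

text \<open>The backward recursion of the Markov property for \<open>trans_density\<close> with exponential factors,
  indexed from the last time as above.\<close>

primrec radial_chain :: "(nat \<Rightarrow> real) \<Rightarrow> (nat \<Rightarrow> real) \<Rightarrow> nat \<Rightarrow> real \<Rightarrow> ennreal" where
  "radial_chain \<sigma> \<tau> 0 x = ennreal (exp (- (\<tau> 0 * x / 2)))"
| "radial_chain \<sigma> \<tau> (Suc j) x = ennreal (exp (- (\<tau> (Suc j) * x / 2))) *
     (\<integral>\<^sup>+z. indicator {0..} z * ennreal (trans_density (\<sigma> j) x z) * radial_chain \<sigma> \<tau> j z \<partial>lborel)"

lemma measurable_radial_chain [measurable]: "radial_chain \<sigma> \<tau> j \<in> borel_measurable borel"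
proof (induction j)
  case 0
  have "radial_chain \<sigma> \<tau> 0 = (\<lambda>x. ennreal (exp (- (\<tau> 0 * x / 2))))" by (simp add: fun_eq_iff)
  then show ?case by simp
next
  case (Suc j)
  note [measurable] = Suc
  have "radial_chain \<sigma> \<tau> (Suc j) = (\<lambda>x. ennreal (exp (- (\<tau> (Suc j) * x / 2))) *
     (\<integral>\<^sup>+z. indicator {0..} z * ennreal (trans_density (\<sigma> j) x z) * radial_chain \<sigma> \<tau> j z \<partial>lborel))"
    by (simp add: fun_eq_iff)
  then show ?case by simp
qed

text \<open>The substitution \<open>x = u\<^sup>2\<close> works because the denominator of \<open>trans_density\<close> factors. The
  factor \<open>2 * v\<close> of \<open>dy = 2 v dv\<close> is split: the \<open>2\<close> is used here, and the \<open>v\<close> goes into the chain.\<close>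

lemma trans_density_square:
  assumes "0 < s" "0 < u" "0 < v"
  shows "2 * trans_density s (u\<^sup>2) (v\<^sup>2) = 1 / u * cauchy_kernel s u v"
proof -
  have "(v\<^sup>2 - u\<^sup>2)\<^sup>2 + 2 * (u\<^sup>2 + v\<^sup>2) * s\<^sup>2 + s ^ 4 = ((u - v)\<^sup>2 + s\<^sup>2) * ((u + v)\<^sup>2 + s\<^sup>2)"
    by algebra
  then show ?thesis
    using assms unfolding cauchy_kernel_eq[OF assms(1)] trans_density_def by simp
qed

lemma integrable_cauchy_kernel_mult:
  assumes s: "0 < s" and f: "integrable lborel f"
  shows "integrable lborel (\<lambda>v. cauchy_kernel s u v * f v)"
proof (rule Bochner_Integration.integrable_bound)
  show "integrable lborel (\<lambda>v. s / pi * (1 / s\<^sup>2) * f v)" by (intro integrable_mult_right f)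
  have [measurable]: "f \<in> borel_measurable borel" using f by (auto dest: borel_measurable_integrable)
  show "(\<lambda>v. cauchy_kernel s u v * f v) \<in> borel_measurable lborel" by measurable
  have "\<bar>cauchy_kernel s u v\<bar> \<le> s / pi * (1 / s\<^sup>2)" for v
  proof -
    have *: "0 \<le> 1 / (x\<^sup>2 + s\<^sup>2)" "1 / (x\<^sup>2 + s\<^sup>2) \<le> 1 / s\<^sup>2" for x
      using s by (auto intro!: divide_left_mono mult_pos_pos add_nonneg_pos)
    have "\<bar>1 / ((u - v)\<^sup>2 + s\<^sup>2) - 1 / ((u + v)\<^sup>2 + s\<^sup>2)\<bar> \<le> 1 / s\<^sup>2"
      using *[of "u - v"] *[of "u + v"] by linarith
    then show ?thesis
      using s unfolding cauchy_kernel_def abs_mult by (intro mult_mono) auto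
  qed
  then show "AE v in lborel. norm (cauchy_kernel s u v * f v) \<le> norm (s / pi * (1 / s\<^sup>2) * f v)"
    unfolding real_norm_def mult.commute[of _ "f _"]
    by (intro AE_I2 abs_mult_left_mono order_trans[OF _ abs_ge_self])
qed

text \<open>In the coordinate \<open>u = sqrt x\<close> the two backward recursions differ by the factor \<open>u\<close> only.\<close>

lemma radial_chain_eq_cauchy_chain:
  assumes "\<And>i. i < j \<Longrightarrow> 0 < \<sigma> i" "\<And>i. i < j \<Longrightarrow> 0 < \<tau> i" and "0 < u"
  shows "radial_chain \<sigma> \<tau> j (u\<^sup>2) * ennreal u = ennreal (cauchy_chain \<sigma> \<tau> j u)"
  using assms
proof (induction j arbitrary: u)
  case 0
  then show ?case by (simp add: mult.commute flip: ennreal_mult)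
next
  case (Suc j)
  have s: "0 < \<sigma> j" and u: "0 < u" using Suc by auto
  have F: "integrable lborel (cauchy_chain \<sigma> \<tau> j)"
    by (rule chain_duality(1)) (use Suc in auto)
  have F0: "0 \<le> cauchy_chain \<sigma> \<tau> j v" for v
    by (rule cauchy_chain_nonneg) (use Suc in auto)
  have "(\<integral>\<^sup>+z. indicator {0..} z * ennreal (trans_density (\<sigma> j) (u\<^sup>2) z) * radial_chain \<sigma> \<tau> j z \<partial>lborel)
    = (\<integral>\<^sup>+z. indicator {0<..} z * (ennreal (trans_density (\<sigma> j) (u\<^sup>2) z) * radial_chain \<sigma> \<tau> j z) \<partial>lborel)"
    by (intro nn_integral_cong) (auto simp: indicator_def trans_density_def)
  also have "\<dots> = (\<integral>\<^sup>+v. indicator {0<..} v *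
      (ennreal (2 * v) * (ennreal (trans_density (\<sigma> j) (u\<^sup>2) (v\<^sup>2)) * radial_chain \<sigma> \<tau> j (v\<^sup>2))) \<partial>lborel)"
    by (rule nn_integral_substitute_square) measurable
  also have "\<dots> = (\<integral>\<^sup>+v. ennreal (1 / u * (cauchy_kernel (\<sigma> j) u v * cauchy_chain \<sigma> \<tau> j v)) \<partial>lborel)"
  proof (rule nn_integral_cong)
    fix v
    show "indicator {0<..} v * (ennreal (2 * v) * (ennreal (trans_density (\<sigma> j) (u\<^sup>2) (v\<^sup>2)) * radial_chain \<sigma> \<tau> j (v\<^sup>2)))
      = ennreal (1 / u * (cauchy_kernel (\<sigma> j) u v * cauchy_chain \<sigma> \<tau> j v))"
    proof (cases "0 < v")
      case True
      have "ennreal (2 * v) * (ennreal (trans_density (\<sigma> j) (u\<^sup>2) (v\<^sup>2)) * radial_chain \<sigma> \<tau> j (v\<^sup>2))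
        = ennreal 2 * ennreal (trans_density (\<sigma> j) (u\<^sup>2) (v\<^sup>2)) * (radial_chain \<sigma> \<tau> j (v\<^sup>2) * ennreal v)"
        using True by (simp add: ennreal_mult ac_simps)
      also have "\<dots> = ennreal (2 * trans_density (\<sigma> j) (u\<^sup>2) (v\<^sup>2)) * ennreal (cauchy_chain \<sigma> \<tau> j v)"
        using Suc True by (simp add: ennreal_mult')
      also have "\<dots> = ennreal (1 / u * (cauchy_kernel (\<sigma> j) u v * cauchy_chain \<sigma> \<tau> j v))"
        unfolding trans_density_square[OF s u True]
        by (subst ennreal_mult[symmetric]) (use s u True F0 cauchy_kernel_nonneg in auto)
      finally show ?thesis using True by simp
    qed (simp add: cauchy_chain_eq_0)
  qed
  also have "\<dots> = ennreal (1 / u * (LINT v|lborel. cauchy_kernel (\<sigma> j) u v * cauchy_chain \<sigma> \<tau> j v))"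
  proof (subst nn_integral_eq_integral)
    have "0 \<le> 1 / u * (cauchy_kernel (\<sigma> j) u v * cauchy_chain \<sigma> \<tau> j v)" for v
      using s u F0[of v] by (cases "0 < v") (auto simp: cauchy_chain_eq_0 cauchy_kernel_nonneg)
    then show "AE v in lborel. 0 \<le> 1 / u * (cauchy_kernel (\<sigma> j) u v * cauchy_chain \<sigma> \<tau> j v)" by simp
  qed (auto intro!: integrable_mult_right integrable_cauchy_kernel_mult s F simp: integral_mult_right_zero simp del: times_divide_eq_left)
  finally have *: "(\<integral>\<^sup>+z. indicator {0..} z * ennreal (trans_density (\<sigma> j) (u\<^sup>2) z) * radial_chain \<sigma> \<tau> j z \<partial>lborel)
    = ennreal (1 / u * (LINT v|lborel. cauchy_kernel (\<sigma> j) u v * cauchy_chain \<sigma> \<tau> j v))" .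
  have "0 \<le> cauchy_kernel (\<sigma> j) u v * cauchy_chain \<sigma> \<tau> j v" for v
    using s u F0[of v] by (cases "0 < v") (auto simp: cauchy_chain_eq_0 cauchy_kernel_nonneg)
  then have "0 \<le> (LINT v|lborel. cauchy_kernel (\<sigma> j) u v * cauchy_chain \<sigma> \<tau> j v)"
    by (intro integral_nonneg_AE) auto
  then show ?case
    unfolding radial_chain.simps * using u by (simp add: mult.commute flip: ennreal_mult)
qed

text \<open>The Markov property is iterated from the last time on, so \<open>\<sigma>\<close> and \<open>\<tau>\<close> list the increments of
  \<open>s\<close> and \<open>t\<close> in reverse order.\<close>

lemma markov_laplace:
  assumes markov: "markov_process_from trans_density N X x"
    and s: "s 0 = 0" "strict_mono_on {0..d} s" and t: "\<And>k. k \<le> d \<Longrightarrow> t k \<le> t (Suc k)"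
    and \<sigma>: "\<And>j. j < d \<Longrightarrow> \<sigma> j = s (d - j) - s (d - Suc j)"
    and \<tau>: "\<And>j. j \<le> d \<Longrightarrow> \<tau> j = t (Suc d - j) - t (d - j)"
  shows "ennreal (\<integral>\<omega>. exp (- (1 / 2) * (\<Sum>k=0..d. (t (k + 1) - t k) * X (s k) \<omega>)) \<partial>N) = radial_chain \<sigma> \<tau> d x"
proof -
  note X = markov_process_fromD(3)[OF markov] and X0 = markov_process_fromD(4)[OF markov]
  interpret prob_space N by (rule markov_process_fromD(1)[OF markov])
  define \<phi> where "\<phi> k y = exp (- ((t (Suc k) - t k) * y / 2))" for k y
  have s0: "0 \<le> s k" if "k \<le> d" for k
    using strict_mono_on_leD[OF s(2), of 0 k] that s(1) by simp
  have prod: "exp (- (1 / 2) * (\<Sum>k=0..d. (t (k + 1) - t k) * X (s k) \<omega>)) = (\<Prod>k\<le>d. \<phi> k (X (s k) \<omega>))" for \<omega>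
    unfolding \<phi>_def atLeast0AtMost by (simp add: exp_sum[symmetric] sum_negf sum_divide_distrib)
  have "ennreal (\<integral>\<omega>. exp (- (1 / 2) * (\<Sum>k=0..d. (t (k + 1) - t k) * X (s k) \<omega>)) \<partial>N)
    = (\<integral>\<^sup>+\<omega>. ennreal (\<Prod>k\<le>d. \<phi> k (X (s k) \<omega>)) \<partial>N)"
    unfolding prod
  proof (rule nn_integral_eq_integral[symmetric])
    show "AE \<omega> in N. 0 \<le> (\<Prod>k\<le>d. \<phi> k (X (s k) \<omega>))"
      by (intro AE_I2 prod_nonneg) (simp add: \<phi>_def)
    show "integrable N (\<lambda>\<omega>. \<Prod>k\<le>d. \<phi> k (X (s k) \<omega>))"
    proof (rule integrable_const_bound[of _ 1])
      show "AE \<omega> in N. norm (\<Prod>k\<le>d. \<phi> k (X (s k) \<omega>)) \<le> 1"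
      proof (rule AE_I2)
        fix \<omega> assume \<omega>: "\<omega> \<in> space N"
        have "(\<Prod>k\<le>d. \<phi> k (X (s k) \<omega>)) \<le> 1"
          by (rule prod_le_1) (use t s0 X0 \<omega> in \<open>auto simp: \<phi>_def\<close>)
        moreover have "0 \<le> (\<Prod>k\<le>d. \<phi> k (X (s k) \<omega>))" by (intro prod_nonneg) (simp add: \<phi>_def)
        ultimately show "norm (\<Prod>k\<le>d. \<phi> k (X (s k) \<omega>)) \<le> 1" by simp
      qed
      have "X (s k) \<in> borel_measurable N" if "k \<le> d" for k using X s0 that by auto
      then show "(\<lambda>\<omega>. \<Prod>k\<le>d. \<phi> k (X (s k) \<omega>)) \<in> borel_measurable N"
        unfolding \<phi>_def by (intro borel_measurable_prod) auto
    qed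
  qed
  also have "\<dots> = radial_chain \<sigma> \<tau> (d - 0) x"
  proof (rule markov_process_nn_integral_prod[where p = trans_density and W = "\<lambda>k. radial_chain \<sigma> \<tau> (d - k)", OF markov s])
    show "\<phi> k y \<le> 1" if "k \<le> d" "0 \<le> y" for k y
      using t[OF that(1)] that(2) by (simp add: \<phi>_def)
    show "radial_chain \<sigma> \<tau> (d - d) y = ennreal (\<phi> d y)" for y
      by (simp add: \<phi>_def \<tau>)
    fix k y assume k: "k < d"
    have e: "d - k = Suc (d - Suc k)" "d - (d - Suc k) = Suc k" "d - (d - k) = k" "Suc d - (d - k) = Suc k"
      using k by auto
    have "\<tau> (d - k) = t (Suc k) - t k" using \<tau>[of "d - k"] e by simp
    moreover have "\<sigma> (d - Suc k) = s (Suc k) - s k" using \<sigma>[of "d - Suc k"] e k by simp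
    ultimately show "radial_chain \<sigma> \<tau> (d - k) y = ennreal (\<phi> k y) * (\<integral>\<^sup>+z. indicator {0..} z *
        ennreal (trans_density (s (Suc k) - s k) y z) * radial_chain \<sigma> \<tau> (d - Suc k) z \<partial>lborel)"
      unfolding e(1) by (simp add: \<phi>_def mult.commute)
  qed (auto simp: \<phi>_def[abs_def] trans_density_def)
  finally show ?thesis by simp
qed

section \<open>Laplace functionals of the excursion\<close>

interpretation lborel_prod: product_sigma_finite "\<lambda>_. lborel :: real measure"
  by standard

text \<open>A joint density of product form is integrated out one coordinate at a time, from the
  last one. The function \<open>f\<close> of the last coordinate is kept arbitrary because
  removing a coordinate replaces it by its image under the kernel.\<close>

lemma nn_integral_PiM_chain:
  fixes K :: "nat \<Rightarrow> real \<Rightarrow> real \<Rightarrow> ennreal" and \<Psi> :: "nat \<Rightarrow> real \<Rightarrow> ennreal"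
  assumes K [measurable]: "\<And>k. (\<lambda>(x, y). K k x y) \<in> borel_measurable (borel \<Otimes>\<^sub>M borel)"
    and \<Psi> [measurable]: "\<And>k. \<Psi> k \<in> borel_measurable borel"
    and step: "\<And>k y. 1 \<le> k \<Longrightarrow> k < n \<Longrightarrow> \<Psi> (Suc k) y = (\<integral>\<^sup>+z. K k z y * \<Psi> k z \<partial>lborel)"
    and n: "1 \<le> n" and f: "f \<in> borel_measurable borel"
  shows "(\<integral>\<^sup>+y. f (y n) * (\<Psi> 1 (y 1) * (\<Prod>k\<in>{1..<n}. K k (y k) (y (Suc k)))) \<partial>(\<Pi>\<^sub>M i\<in>{1..n}. lborel))
    = (\<integral>\<^sup>+z. f z * \<Psi> n z \<partial>lborel)"
  using n f step
proof (induction n arbitrary: f rule: nat_induct_at_least)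
  case base
  note [measurable] = base(1)
  show ?case
    using lborel_prod.product_nn_integral_singleton[of "\<lambda>y. f y * \<Psi> 1 y" "Suc 0"] by simp
next
  case (Suc n)
  note [measurable] = Suc.prems(1)
  have ins: "{1..Suc n} = insert (Suc n) {1..n}" using Suc by auto
  have m: "(\<lambda>y. f (y (Suc n)) * (\<Psi> 1 (y 1) * (\<Prod>k\<in>{1..<Suc n}. K k (y k) (y (Suc k)))))
    \<in> borel_measurable (\<Pi>\<^sub>M i\<in>insert (Suc n) {1..n}. lborel)"
  proof -
    have "(\<lambda>y. K k (y k) (y (Suc k))) \<in> borel_measurable (\<Pi>\<^sub>M i\<in>insert (Suc n) {1..n}. lborel)"
      if "k \<in> {1..<Suc n}" for k
    proof -
      have "k \<in> insert (Suc n) {1..n}" "Suc k \<in> insert (Suc n) {1..n}" using that by auto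
      then show ?thesis by measurable
    qed
    moreover have "1 \<in> insert (Suc n) {1..n}" using Suc by auto
    ultimately show ?thesis by measurable
  qed
  have "(\<integral>\<^sup>+y. f (y (Suc n)) * (\<Psi> 1 (y 1) * (\<Prod>k\<in>{1..<Suc n}. K k (y k) (y (Suc k)))) \<partial>(\<Pi>\<^sub>M i\<in>{1..Suc n}. lborel))
    = (\<integral>\<^sup>+x. (\<integral>\<^sup>+y. f y * (\<Psi> 1 (x 1) * (\<Prod>k\<in>{1..<n}. K k (x k) (x (Suc k))) * K n (x n) y) \<partial>lborel) \<partial>(\<Pi>\<^sub>M i\<in>{1..n}. lborel))"
    unfolding ins
  proof (subst lborel_prod.product_nn_integral_insert[OF _ _ m], goal_cases)
    case 3
    have "(\<Prod>k\<in>{1..<Suc n}. K k ((x(Suc n := y)) k) ((x(Suc n := y)) (Suc k)))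
        = (\<Prod>k\<in>{1..<n}. K k (x k) (x (Suc k))) * K n (x n) y" for x :: "nat \<Rightarrow> real" and y
      using Suc by (simp add: prod.atLeastLessThan_Suc)
    then show ?case using Suc by (intro nn_integral_cong) (simp add: mult.assoc)
  qed auto
  also have "\<dots> = (\<integral>\<^sup>+x. (\<integral>\<^sup>+y. f y * K n (x n) y \<partial>lborel) * (\<Psi> 1 (x 1) * (\<Prod>k\<in>{1..<n}. K k (x k) (x (Suc k)))) \<partial>(\<Pi>\<^sub>M i\<in>{1..n}. lborel))"
    by (intro nn_integral_cong, subst nn_integral_multc[symmetric]) (simp_all add: ac_simps)
  also have "\<dots> = (\<integral>\<^sup>+z. (\<integral>\<^sup>+y. f y * K n z y \<partial>lborel) * \<Psi> n z \<partial>lborel)"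
    by (rule Suc.IH) (measurable, use Suc.prems in auto)
  also have "\<dots> = (\<integral>\<^sup>+z. (\<integral>\<^sup>+y. f y * (K n z y * \<Psi> n z) \<partial>lborel) \<partial>lborel)"
    by (intro nn_integral_cong, subst nn_integral_multc[symmetric]) (simp_all add: ac_simps)
  also have "\<dots> = (\<integral>\<^sup>+y. (\<integral>\<^sup>+z. f y * (K n z y * \<Psi> n z) \<partial>lborel) \<partial>lborel)"
    by (rule lborel_pair.Fubini') measurable
  also have "\<dots> = (\<integral>\<^sup>+y. f y * \<Psi> (Suc n) y \<partial>lborel)"
    using Suc by (simp add: nn_integral_cmult)
  finally show ?case .
qed

text \<open>The exponential weights are distributed over the factors of the joint density, the first
  one to the entrance density and each other one to the kernel that leads to its point.\<close>

lemma excursion_laplace: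
  fixes \<Psi> :: "nat \<Rightarrow> real \<Rightarrow> ennreal"
  assumes exc: "brownian_excursion M W" and d: "1 \<le> d"
    and t: "0 < t 1" "strict_mono_on {1..d} t" "t d < 1"
    and \<Psi>_meas: "\<And>k. \<Psi> k \<in> borel_measurable borel"
    and \<Psi>_1: "\<And>y. \<Psi> 1 y = ennreal (exp (- (c 1 * y)) * exc_entrance (t 1) y)"
    and \<Psi>_step: "\<And>k y. 1 \<le> k \<Longrightarrow> k < d \<Longrightarrow> \<Psi> (Suc k) y =
        (\<integral>\<^sup>+z. ennreal (exc_kernel (t (Suc k) - t k) z y * exp (- (c (Suc k) * y))) * \<Psi> k z \<partial>lborel)"
  shows "(\<integral>\<^sup>+\<omega>. ennreal (exp (- (\<Sum>i=1..d. c i * W (t i) \<omega>))) \<partial>M)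
    = (\<integral>\<^sup>+z. ennreal (sqrt (8 * pi) * exc_entrance (1 - t d) z) * \<Psi> d z \<partial>lborel)"
proof -
  let ?P = "\<Pi>\<^sub>M i\<in>{1..d}. lborel :: real measure"
  let ?K = "\<lambda>k z y. exc_kernel (t (Suc k) - t k) z y * exp (- (c (Suc k) * y))"
  have dist: "distributed M ?P (\<lambda>\<omega>. \<lambda>i\<in>{1..d}. W (t i) \<omega>) (\<lambda>y. ennreal (exc_density d t y))"
    using exc d t unfolding brownian_excursion_def by blast
  have t_diff: "0 < t (Suc k) - t k" if "1 \<le> k" "k < d" for k
    using strict_mono_onD[OF t(2), of k "Suc k"] that by auto
  have K0: "0 \<le> ?K k z y" if "1 \<le> k" "k < d" for k z y
    using exc_kernel_nonneg[OF t_diff[OF that]] by simp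
  have "(\<integral>\<^sup>+\<omega>. ennreal (exp (- (\<Sum>i=1..d. c i * W (t i) \<omega>))) \<partial>M)
      = (\<integral>\<^sup>+y. ennreal (exc_density d t y) * ennreal (exp (- (\<Sum>i=1..d. c i * y i))) \<partial>?P)"
    by (subst distributed_nn_integral[OF dist]) auto
  also have "\<dots> = (\<integral>\<^sup>+y. ennreal (sqrt (8 * pi) * exc_entrance (1 - t d) (y d)) *
      (\<Psi> 1 (y 1) * (\<Prod>k\<in>{1..<d}. ennreal (?K k (y k) (y (Suc k))))) \<partial>?P)"
  proof (rule nn_integral_cong)
    fix y :: "nat \<Rightarrow> real"
    have "(\<Sum>i=1..d. c i * y i) = c 1 * y 1 + (\<Sum>i=Suc 1..d. c i * y i)"
      by (rule sum.atLeast_Suc_atMost[OF d])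
    also have "(\<Sum>i=Suc 1..d. c i * y i) = (\<Sum>k\<in>{1..<d}. c (Suc k) * y (Suc k))"
      by (rule sum.reindex_bij_witness[of _ Suc "\<lambda>i. i - 1"]) auto
    finally have E: "exp (- (\<Sum>i=1..d. c i * y i)) = exp (- (c 1 * y 1)) * (\<Prod>k\<in>{1..<d}. exp (- (c (Suc k) * y (Suc k))))"
      by (simp add: exp_add[symmetric] exp_sum[symmetric] sum_negf)
    have "(\<Prod>k\<in>{1..<d}. ennreal (?K k (y k) (y (Suc k)))) = ennreal (\<Prod>k\<in>{1..<d}. ?K k (y k) (y (Suc k)))"
      by (rule prod_ennreal) (use K0 in auto)
    moreover have "0 \<le> (\<Prod>k\<in>{1..<d}. ?K k (y k) (y (Suc k)))"
      by (rule prod_nonneg) (use K0 in auto)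
    moreover have "0 \<le> exc_entrance (t 1) (y 1)" "0 \<le> exc_entrance (1 - t d) (y d)"
      using t by (auto intro: exc_entrance_nonneg)
    ultimately show "ennreal (exc_density d t y) * ennreal (exp (- (\<Sum>i=1..d. c i * y i)))
      = ennreal (sqrt (8 * pi) * exc_entrance (1 - t d) (y d)) *
      (\<Psi> 1 (y 1) * (\<Prod>k\<in>{1..<d}. ennreal (?K k (y k) (y (Suc k)))))"
      unfolding \<Psi>_1 E exc_density_def
      by (simp add: prod.distrib prod_nonneg ac_simps flip: ennreal_mult' ennreal_mult'')
  qed
  also have "\<dots> = (\<integral>\<^sup>+z. ennreal (sqrt (8 * pi) * exc_entrance (1 - t d) z) * \<Psi> d z \<partial>lborel)"
    by (rule nn_integral_PiM_chain[where K = "\<lambda>k z y. ennreal (?K k z y)"])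
       (use d \<Psi>_meas \<Psi>_step in \<open>auto intro!: measurable_compose[OF measurable_kernels(1)]\<close>)
  finally show ?thesis .
qed

lemma exc_entrance_scale:
  assumes "0 < v" "0 < t"
  shows "exc_entrance (v * t) (sqrt v * a) = exc_entrance t a / v"
proof -
  have "sqrt (2 * pi * (v * t) ^ 3) = v * sqrt v * sqrt (2 * pi * t ^ 3)"
    using assms by (simp add: power_mult_distrib power3_eq_cube real_sqrt_mult)
  moreover have "(sqrt v * a)\<^sup>2 / (2 * (v * t)) = a\<^sup>2 / (2 * t)"
    using assms by (simp add: power_mult_distrib)
  ultimately show ?thesis
    using assms unfolding exc_entrance_def by (simp add: indicator_def zero_less_mult_iff)
qed

lemma exc_kernel_scale:
  assumes "0 < v" "0 < t"
  shows "sqrt v * exc_kernel (v * t) (sqrt v * a) (sqrt v * b) = exc_kernel t a b"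
proof -
  have "(sqrt v * a - sqrt v * b)\<^sup>2 / (2 * (v * t)) = (a - b)\<^sup>2 / (2 * t)"
    "(sqrt v * a + sqrt v * b)\<^sup>2 / (2 * (v * t)) = (a + b)\<^sup>2 / (2 * t)"
    using assms by (simp_all add: power_mult_distrib flip: right_diff_distrib distrib_left)
  moreover have "sqrt (2 * pi * (v * t)) = sqrt v * sqrt (2 * pi * t)"
    by (simp add: real_sqrt_mult)
  ultimately show ?thesis
    using assms unfolding exc_kernel_def by (simp add: indicator_def zero_less_mult_iff)
qed

lemma integrable_exc_kernel_mult:
  assumes t: "0 < t" and f: "integrable lborel f"
  shows "integrable lborel (\<lambda>b. exc_kernel t a b * f b)"
proof (rule Bochner_Integration.integrable_bound)
  show "integrable lborel (\<lambda>b. 1 / sqrt (2 * pi * t) * f b)" by (intro integrable_mult_right f)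
  have [measurable]: "f \<in> borel_measurable borel" using f by (auto dest: borel_measurable_integrable)
  show "(\<lambda>b. exc_kernel t a b * f b) \<in> borel_measurable lborel" by measurable
  have "\<bar>exc_kernel t a b\<bar> \<le> 1 / sqrt (2 * pi * t)" for b
  proof -
    have *: "0 \<le> exp (- (x\<^sup>2 / (2 * t)))" "exp (- (x\<^sup>2 / (2 * t))) \<le> 1" for x
      using t by auto
    have "\<bar>exp (- ((a - b)\<^sup>2 / (2 * t))) - exp (- ((a + b)\<^sup>2 / (2 * t)))\<bar> \<le> 1"
      using *[of "a - b"] *[of "a + b"] by linarith
    then show ?thesis
      using t unfolding exc_kernel_def by (auto simp: indicator_def abs_mult divide_right_mono)
  qed
  then show "AE b in lborel. norm (exc_kernel t a b * f b) \<le> norm (1 / sqrt (2 * pi * t) * f b)"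
    unfolding real_norm_def mult.commute[of _ "f _"]
    by (intro AE_I2 abs_mult_left_mono order_trans[OF _ abs_ge_self])
qed

lemma nn_integral_scale:
  assumes [measurable]: "f \<in> borel_measurable borel" and "0 < (c::real)"
  shows "(\<integral>\<^sup>+x. f x \<partial>lborel) = ennreal c * (\<integral>\<^sup>+x. f (c * x) \<partial>lborel)"
  using nn_integral_real_affine[of f c 0] assms by simp

text \<open>Brownian scaling: \<open>W (v t) / sqrt v\<close> is an excursion of length \<open>1 / v\<close>, observed on \<open>[0, 1]\<close>.
  Its last time step, from the largest observation time to \<open>1 / v\<close>, exceeds \<open>\<tau> (Suc n)\<close> by
  \<open>1 / v - 1\<close>, which is therefore the parameter \<open>r\<close> at which the chain is closed.\<close>

lemma scaled_excursion_laplace: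
  assumes exc: "brownian_excursion M W" and v: "0 < v" "v < 1"
    and pos: "\<And>i. i \<le> n \<Longrightarrow> 0 < \<sigma> i" "\<And>i. i \<le> n \<Longrightarrow> 0 < \<tau> i" and last: "0 \<le> \<tau> (Suc n)"
    and total: "(\<Sum>j\<le>Suc n. \<tau> j) = 1"
  shows "(\<integral>\<^sup>+\<omega>. ennreal (exp (- (\<Sum>i=1..Suc n. \<sigma> (i - 1) / sqrt v * W (v * (\<Sum>j<i. \<tau> j)) \<omega>))) \<partial>M)
    = ennreal (sqrt (2 / pi) / (v * sqrt v)) *
      (\<integral>\<^sup>+u. ennreal (u * exp (- ((1 / v - 1) * u\<^sup>2 / 2)) * cauchy_chain \<sigma> \<tau> (Suc n) u) \<partial>lborel)"
proof -
  define t where "t i = v * (\<Sum>j<i. \<tau> j)" for i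
  \<comment> \<open>The scaled chain solves the recursion of the excursion without any power of \<open>v\<close> building up:
      the entrance density scales by \<open>1 / v\<close> and the kernels scale like densities.\<close>
  define \<Psi> where "\<Psi> k y = ennreal (excursion_chain \<sigma> \<tau> (k - 1) (y / sqrt v) / v)" for k y
  let ?\<kappa> = "\<tau> (Suc n) + (1 / v - 1)"
  have sv: "0 < sqrt v" using v by simp
  have \<kappa>: "0 < ?\<kappa>" using v last by (simp add: add_nonneg_pos)
  have t_last: "1 - t (Suc n) = v * ?\<kappa>"
  proof -
    have "(\<Sum>j<Suc n. \<tau> j) = 1 - \<tau> (Suc n)" using total by (simp add: lessThan_Suc_atMost)
    then show ?thesis unfolding t_def using v by (simp add: right_diff_distrib distrib_left del: sum.lessThan_Suc)
  qed
  have t_Suc: "t (Suc k) - t k = v * \<tau> k" for k by (simp add: t_def ring_distribs)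
  have chain0: "0 \<le> excursion_chain \<sigma> \<tau> k a" if "k \<le> n" for k a
    by (rule excursion_chain_nonneg) (use pos that in auto)
  have duality: "(\<integral>\<^sup>+u. ennreal (u * exp (- ((1 / v - 1) * u\<^sup>2 / 2)) * cauchy_chain \<sigma> \<tau> (Suc n) u) \<partial>lborel)
    = ennreal (2 * pi) * (\<integral>\<^sup>+a. ennreal (exc_entrance ?\<kappa> a * excursion_chain \<sigma> \<tau> n a) \<partial>lborel)"
    by (rule chain_duality_last) (use pos \<kappa> in auto)
  have [measurable]: "\<Psi> k \<in> borel_measurable borel" for k
    unfolding \<Psi>_def by measurable
  have "(\<integral>\<^sup>+\<omega>. ennreal (exp (- (\<Sum>i=1..Suc n. \<sigma> (i - 1) / sqrt v * W (t i) \<omega>))) \<partial>M)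
    = (\<integral>\<^sup>+z. ennreal (sqrt (8 * pi) * exc_entrance (1 - t (Suc n)) z) * \<Psi> (Suc n) z \<partial>lborel)"
  proof (rule excursion_laplace[OF exc])
    show "0 < t 1" using v pos by (simp add: t_def)
    show "strict_mono_on {1..Suc n} t"
    proof (rule strict_mono_onI)
      fix i j assume ij: "i \<in> {1..Suc n}" "j \<in> {1..Suc n}" "i < j"
      have "(\<Sum>k<j. \<tau> k) = (\<Sum>k<i. \<tau> k) + (\<Sum>k\<in>{i..<j}. \<tau> k)"
        using sum.atLeastLessThan_concat[of 0 i j \<tau>] ij by (simp add: lessThan_atLeast0)
      moreover have "0 < (\<Sum>k\<in>{i..<j}. \<tau> k)"
        by (rule sum_pos) (use ij pos in auto)
      ultimately show "t i < t j" using v by (simp add: t_def)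
    qed
    show "t (Suc n) < 1" using t_last mult_pos_pos[OF v(1) \<kappa>] by simp
    show "\<Psi> 1 y = ennreal (exp (- (\<sigma> (1 - 1) / sqrt v * y)) * exc_entrance (t 1) y)" for y
      using exc_entrance_scale[of v "\<tau> 0" "y / sqrt v"] v pos[of 0] by (simp add: \<Psi>_def t_def)
    fix k y assume k: "1 \<le> k" "k < Suc n"
    then obtain j where j: "k = Suc j" by (cases k) auto
    have tk: "0 < \<tau> k" using pos k by simp
    have int: "integrable lborel (excursion_chain \<sigma> \<tau> j)"
      by (rule chain_duality) (use pos k j in auto)
    let ?e = "exp (- (\<sigma> k / sqrt v * y)) / v"
    have e0: "0 \<le> ?e" using v by simp
    have "(\<integral>\<^sup>+z. ennreal (exc_kernel (t (Suc k) - t k) z y * exp (- (\<sigma> (Suc k - 1) / sqrt v * y))) * \<Psi> k z \<partial>lborel)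
      = (\<integral>\<^sup>+b. ennreal (sqrt v) * (ennreal (exc_kernel (v * \<tau> k) (sqrt v * b) y * exp (- (\<sigma> k / sqrt v * y))) *
           ennreal (excursion_chain \<sigma> \<tau> j b / v)) \<partial>lborel)"
      using sv unfolding t_Suc \<Psi>_def
      by (subst nn_integral_scale[OF _ sv]) (simp_all add: nn_integral_cmult j)
    also have "\<dots> = (\<integral>\<^sup>+b. ennreal (?e * (exc_kernel (\<tau> k) (y / sqrt v) b * excursion_chain \<sigma> \<tau> j b)) \<partial>lborel)"
    proof (rule nn_integral_cong)
      fix b
      have g: "sqrt v * exc_kernel (v * \<tau> k) (sqrt v * b) y = exc_kernel (\<tau> k) (y / sqrt v) b"
        using exc_kernel_scale[OF v(1) tk, of b "y / sqrt v"] sv by (simp add: exc_kernel_commute[of _ b])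
      have "ennreal (sqrt v) * (ennreal (exc_kernel (v * \<tau> k) (sqrt v * b) y * exp (- (\<sigma> k / sqrt v * y))) *
           ennreal (excursion_chain \<sigma> \<tau> j b / v))
        = ennreal (sqrt v * (exc_kernel (v * \<tau> k) (sqrt v * b) y * exp (- (\<sigma> k / sqrt v * y))) * (excursion_chain \<sigma> \<tau> j b / v))"
        using v tk exc_kernel_nonneg[of "v * \<tau> k"] chain0[of j b] k j
        by (simp add: mult.assoc flip: ennreal_mult)
      also have "sqrt v * (exc_kernel (v * \<tau> k) (sqrt v * b) y * exp (- (\<sigma> k / sqrt v * y))) * (excursion_chain \<sigma> \<tau> j b / v)
        = ?e * (exc_kernel (\<tau> k) (y / sqrt v) b * excursion_chain \<sigma> \<tau> j b)"
        unfolding g[symmetric] by simp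
      finally show "ennreal (sqrt v) * (ennreal (exc_kernel (v * \<tau> k) (sqrt v * b) y * exp (- (\<sigma> k / sqrt v * y))) *
           ennreal (excursion_chain \<sigma> \<tau> j b / v))
        = ennreal (?e * (exc_kernel (\<tau> k) (y / sqrt v) b * excursion_chain \<sigma> \<tau> j b))" .
    qed
    also have "\<dots> = ennreal (LINT b|lborel. ?e * (exc_kernel (\<tau> k) (y / sqrt v) b * excursion_chain \<sigma> \<tau> j b))"
      by (intro nn_integral_eq_integral integrable_mult_right integrable_exc_kernel_mult tk int AE_I2 mult_nonneg_nonneg e0 exc_kernel_nonneg chain0)
         (use k j in auto)
    also have "\<dots> = \<Psi> (Suc k) y"
      unfolding integral_mult_right_zero \<Psi>_def by (simp add: j)
    finally show "\<Psi> (Suc k) y = (\<integral>\<^sup>+z. ennreal (exc_kernel (t (Suc k) - t k) z y *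
        exp (- (\<sigma> (Suc k - 1) / sqrt v * y))) * \<Psi> k z \<partial>lborel)" ..
  qed auto
  also have "\<dots> = (\<integral>\<^sup>+a. ennreal (sqrt v) * (ennreal (sqrt (8 * pi) * exc_entrance (v * ?\<kappa>) (sqrt v * a)) *
      ennreal (excursion_chain \<sigma> \<tau> n a / v)) \<partial>lborel)"
    using sv unfolding t_last \<Psi>_def
    by (subst nn_integral_scale[OF _ sv]) (simp_all add: nn_integral_cmult)
  also have "\<dots> = (\<integral>\<^sup>+a. ennreal (sqrt (8 * pi) / (v * sqrt v)) *
      ennreal (exc_entrance ?\<kappa> a * excursion_chain \<sigma> \<tau> n a) \<partial>lborel)"
  proof (rule nn_integral_cong)
    fix a
    have "sqrt v / v * (1 / v) = 1 / (v * sqrt v)"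
      using sv real_sqrt_mult_self[of v] v by (simp add: field_simps)
    moreover have "sqrt v * (sqrt (8 * pi) * (exc_entrance ?\<kappa> a / v)) * (excursion_chain \<sigma> \<tau> n a / v)
      = (sqrt v / v * (1 / v)) * (sqrt (8 * pi) * (exc_entrance ?\<kappa> a * excursion_chain \<sigma> \<tau> n a))" by simp
    ultimately have "sqrt v * (sqrt (8 * pi) * (exc_entrance ?\<kappa> a / v)) * (excursion_chain \<sigma> \<tau> n a / v)
      = sqrt (8 * pi) / (v * sqrt v) * (exc_entrance ?\<kappa> a * excursion_chain \<sigma> \<tau> n a)"
      by (simp only:) simp
    then show "ennreal (sqrt v) * (ennreal (sqrt (8 * pi) * exc_entrance (v * ?\<kappa>) (sqrt v * a)) *
      ennreal (excursion_chain \<sigma> \<tau> n a / v))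
      = ennreal (sqrt (8 * pi) / (v * sqrt v)) * ennreal (exc_entrance ?\<kappa> a * excursion_chain \<sigma> \<tau> n a)"
      unfolding exc_entrance_scale[OF v(1) \<kappa>]
      using v exc_entrance_nonneg[OF \<kappa>, of a] chain0[of n a]
      by (simp only: ennreal_mult[symmetric] mult_nonneg_nonneg divide_nonneg_nonneg real_sqrt_ge_zero less_imp_le pi_ge_zero mult.assoc[symmetric] zero_le_numeral order_refl)
  qed
  also have "\<dots> = ennreal (sqrt (8 * pi) / (v * sqrt v)) *
      (\<integral>\<^sup>+a. ennreal (exc_entrance ?\<kappa> a * excursion_chain \<sigma> \<tau> n a) \<partial>lborel)"
    by (rule nn_integral_cmult) measurable
  also have "sqrt (8 * pi) / (v * sqrt v) = sqrt (2 / pi) / (v * sqrt v) * (2 * pi)"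
  proof -
    have "sqrt (8 * pi) = sqrt (2 / pi * (2 * pi)\<^sup>2)" by (simp add: power2_eq_square)
    also have "\<dots> = sqrt (2 / pi) * (2 * pi)" by (simp only: real_sqrt_mult real_sqrt_abs) simp
    finally show ?thesis by simp
  qed
  also have "ennreal \<dots> = ennreal (sqrt (2 / pi) / (v * sqrt v)) * ennreal (2 * pi)"
    using v by (intro ennreal_mult) auto
  also have "\<dots> * (\<integral>\<^sup>+a. ennreal (exc_entrance ?\<kappa> a * excursion_chain \<sigma> \<tau> n a) \<partial>lborel)
    = ennreal (sqrt (2 / pi) / (v * sqrt v)) *
      (\<integral>\<^sup>+u. ennreal (u * exp (- ((1 / v - 1) * u\<^sup>2 / 2)) * cauchy_chain \<sigma> \<tau> (Suc n) u) \<partial>lborel)"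
    unfolding duality by (simp only: mult.assoc)
  finally show ?thesis unfolding t_def .
qed

section \<open>The meander as a mixture of excursions\<close>

text \<open>Evaluation at a random time is not measurable on an uncountable product of lines, but it is for
  continuous paths: it is the limit of evaluations at the times rounded down to multiples of
  \<open>1 / (m + 1)\<close>, and each of these involves countably many times only.\<close>

lemma borel_measurable_path_evaluation:
  fixes W :: "real \<Rightarrow> 'a \<Rightarrow> real"
  assumes meas: "\<And>x. x \<in> {0..1} \<Longrightarrow> W x \<in> borel_measurable H"
    and cont: "\<And>\<omega>. \<omega> \<in> space H \<Longrightarrow> continuous_on {0..1} (\<lambda>x. W x \<omega>)"
  shows "(\<lambda>(x, \<omega>). W (max 0 (min 1 x)) \<omega>) \<in> borel_measurable (borel \<Otimes>\<^sub>M H)"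
proof -
  let ?k = "\<lambda>x::real. max 0 (min 1 x)"
  let ?g = "\<lambda>m x. real_of_int \<lfloor>real (Suc m) * x\<rfloor> / real (Suc m)"
  show ?thesis
  proof (rule borel_measurable_LIMSEQ_real[where u = "\<lambda>m (x, \<omega>). W (?k (?g m x)) \<omega>"])
    fix m
    have "(\<lambda>z. (\<lambda>i z. W (?k (real_of_int i / real (Suc m))) (snd z)) \<lfloor>real (Suc m) * fst z\<rfloor> z)
      \<in> borel_measurable (borel \<Otimes>\<^sub>M H)"
    proof (rule measurable_compose_countable[where g = "\<lambda>z. \<lfloor>real (Suc m) * fst z\<rfloor>"
          and f = "\<lambda>i z. W (?k (real_of_int i / real (Suc m))) (snd z)"])
      show "(\<lambda>z. W (?k (real_of_int i / real (Suc m))) (snd z)) \<in> borel_measurable (borel \<Otimes>\<^sub>M H)" for i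
        by (rule measurable_compose[OF measurable_snd meas]) auto
      show "(\<lambda>z. \<lfloor>real (Suc m) * fst z\<rfloor>) \<in> measurable (borel \<Otimes>\<^sub>M H) (count_space UNIV)"
        by (rule measurable_compose[OF _ measurable_real_floor]) simp
    qed
    then show "(\<lambda>(x, \<omega>). W (?k (?g m x)) \<omega>) \<in> borel_measurable (borel \<Otimes>\<^sub>M H)"
      unfolding case_prod_beta .
  next
    fix z :: "real \<times> 'a" assume z: "z \<in> space (borel \<Otimes>\<^sub>M H)"
    obtain x \<omega> where zx: "z = (x, \<omega>)" by (cases z)
    have \<omega>: "\<omega> \<in> space H" using z zx by (simp add: space_pair_measure)
    have "(\<lambda>m. ?g m x) \<longlonglongrightarrow> x"
    proof (rule tendsto_sandwich)
      show "\<forall>\<^sub>F m in sequentially. x - 1 / real (Suc m) \<le> ?g m x"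
      proof (intro always_eventually allI)
        fix m
        have "real (Suc m) * x - 1 \<le> real_of_int \<lfloor>real (Suc m) * x\<rfloor>" by linarith
        then have "(real (Suc m) * x - 1) / real (Suc m) \<le> ?g m x" by (rule divide_right_mono) simp
        moreover have "(real (Suc m) * x - 1) / real (Suc m) = x - 1 / real (Suc m)"
          by (simp add: diff_divide_distrib del: of_nat_Suc)
        ultimately show "x - 1 / real (Suc m) \<le> ?g m x" by linarith
      qed
      show "\<forall>\<^sub>F m in sequentially. ?g m x \<le> x"
      proof (intro always_eventually allI)
        fix m
        have "?g m x \<le> (real (Suc m) * x) / real (Suc m)"
          by (rule divide_right_mono[OF of_int_floor_le]) simp
        moreover have "(real (Suc m) * x) / real (Suc m) = x" by (simp del: of_nat_Suc)
        ultimately show "?g m x \<le> x" by linarith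
      qed
      show "(\<lambda>m. x - 1 / real (Suc m)) \<longlonglongrightarrow> x"
        by real_asymp
    qed (rule tendsto_const)
    then have "(\<lambda>m. ?k (?g m x)) \<longlonglongrightarrow> ?k x"
      by (intro tendsto_max tendsto_min tendsto_const)
    then have "(\<lambda>m. W (?k (?g m x)) \<omega>) \<longlonglongrightarrow> W (?k x) \<omega>"
      by (rule continuous_on_tendsto_compose[OF cont[OF \<omega>]]) auto
    then show "(\<lambda>m. case z of (x, \<omega>) \<Rightarrow> W (?k (?g m x)) \<omega>) \<longlonglongrightarrow> (case z of (x, \<omega>) \<Rightarrow> W (?k x) \<omega>)"
      by (simp add: zx)
  qed
qed

text \<open>Independence of \<open>V\<close> from a whole \<open>\<sigma>\<close>-algebra \<open>H\<close> separates the two integrations: the law of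
  \<open>(V, \<omega>)\<close> on \<open>borel \<Otimes>\<^sub>M H\<close> is a product measure.\<close>

lemma (in prob_space) nn_integral_indep_density:
  assumes V: "distributed M lborel V f" and H: "subalgebra M H"
    and indep: "indep_set (sets (vimage_algebra (space M) V borel)) (sets H)"
    and G [measurable]: "(\<lambda>(v, \<omega>). G v \<omega>) \<in> borel_measurable (borel \<Otimes>\<^sub>M H)"
  shows "(\<integral>\<^sup>+\<omega>. G (V \<omega>) \<omega> \<partial>M) = (\<integral>\<^sup>+v. f v * (\<integral>\<^sup>+\<omega>. G v \<omega> \<partial>M) \<partial>lborel)"
proof -
  have sp: "space H = space M" and sub: "sets H \<subseteq> sets M" using H by (auto simp: subalgebra_def)
  have Vm [measurable]: "V \<in> borel_measurable M" using distributed_measurable[OF V] by simp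
  have idm [measurable]: "(\<lambda>\<omega>. \<omega>) \<in> measurable M H"
    by (rule measurableI) (use sp sub sets.sets_into_space in auto)
  interpret D: prob_space "distr M H (\<lambda>\<omega>. \<omega>)" by (rule prob_space_distr[OF idm])
  interpret V: prob_space "distr M borel V" by (rule prob_space_distr[OF Vm])
  have eq: "distr M borel V \<Otimes>\<^sub>M distr M H (\<lambda>\<omega>. \<omega>) = distr M (borel \<Otimes>\<^sub>M H) (\<lambda>\<omega>. (V \<omega>, \<omega>))"
  proof (rule pair_measure_eqI)
    fix A B assume "A \<in> sets (distr M borel V)" "B \<in> sets (distr M H (\<lambda>\<omega>. \<omega>))"
    then have A [measurable]: "A \<in> sets borel" and B [measurable]: "B \<in> sets H" by auto
    have B_sub: "B \<subseteq> space M" using sets.sets_into_space[OF B] sp by simp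
    have "V -` A \<inter> space M \<in> sets (vimage_algebra (space M) V borel)" by (rule in_vimage_algebra[OF A])
    then have "prob ((V -` A \<inter> space M) \<inter> B) = prob (V -` A \<inter> space M) * prob B"
      using indep B unfolding indep_sets2_eq by blast
    moreover have "(\<lambda>\<omega>. (V \<omega>, \<omega>)) -` (A \<times> B) \<inter> space M = (V -` A \<inter> space M) \<inter> B"
      "(\<lambda>\<omega>. \<omega>) -` B \<inter> space M = B"
      using B_sub by auto
    ultimately show "emeasure (distr M borel V) A * emeasure (distr M H (\<lambda>\<omega>. \<omega>)) B
      = emeasure (distr M (borel \<Otimes>\<^sub>M H) (\<lambda>\<omega>. (V \<omega>, \<omega>))) (A \<times> B)"
      by (simp add: emeasure_distr emeasure_eq_measure ennreal_mult)
  qed (auto intro: V.sigma_finite_measure_axioms D.sigma_finite_measure_axioms)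
  have Gv: "(\<lambda>\<omega>. G v \<omega>) \<in> borel_measurable H" for v
    using measurable_compose[OF _ G, of "\<lambda>\<omega>. (v, \<omega>)" H] by simp
  have inner: "(\<integral>\<^sup>+\<omega>. G v \<omega> \<partial>distr M H (\<lambda>\<omega>. \<omega>)) = (\<integral>\<^sup>+\<omega>. G v \<omega> \<partial>M)" for v
    by (rule nn_integral_distr[OF idm]) (use Gv in simp)
  have [measurable]: "(\<lambda>v. \<integral>\<^sup>+\<omega>. G v \<omega> \<partial>M) \<in> borel_measurable borel"
    unfolding inner[symmetric] by measurable
  have "(\<integral>\<^sup>+\<omega>. G (V \<omega>) \<omega> \<partial>M) = (\<integral>\<^sup>+z. (case z of (v, \<omega>) \<Rightarrow> G v \<omega>) \<partial>distr M (borel \<Otimes>\<^sub>M H) (\<lambda>\<omega>. (V \<omega>, \<omega>)))"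
    by (subst nn_integral_distr) auto
  also have "\<dots> = (\<integral>\<^sup>+v. \<integral>\<^sup>+\<omega>. G v \<omega> \<partial>distr M H (\<lambda>\<omega>. \<omega>) \<partial>distr M borel V)"
    unfolding eq[symmetric] by (subst D.nn_integral_fst[symmetric]) auto
  also have "\<dots> = (\<integral>\<^sup>+x. (\<integral>\<^sup>+\<omega>. G (V x) \<omega> \<partial>M) \<partial>M)"
    unfolding inner by (subst nn_integral_distr) auto
  also have "\<dots> = (\<integral>\<^sup>+v. f v * (\<integral>\<^sup>+\<omega>. G v \<omega> \<partial>M) \<partial>lborel)"
    by (rule distributed_nn_integral[OF V, symmetric]) simp
  finally show ?thesis .
qed

lemma beta_density_eq_0: "v \<notin> {0<..<1} \<Longrightarrow> beta_density a b v = 0"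
  by (auto simp: beta_density_def)

lemma beta_density_posD: "0 < beta_density a b v \<Longrightarrow> v \<in> {0<..<1}"
  using beta_density_eq_0[of v a b] by (metis less_irrefl)

text \<open>The times \<open>V * \<rho> i\<close> lie in \<open>[0, 1]\<close> almost surely; clamping them to that interval makes the
  integrand jointly measurable everywhere. The excursion is part
  of the conclusion because its law determines the inner integral.\<close>

lemma meander_laplace_mixture:
  assumes meander: "generalized_bessel_meander M \<delta> B"
    and \<rho>: "\<And>i. i \<in> I \<Longrightarrow> 0 \<le> \<rho> i \<and> \<rho> i \<le> 1"
  obtains W where "brownian_excursion M W"
    and "AE \<omega> in M. B 0 \<omega> = 0"
    and "(\<integral>\<^sup>+\<omega>. ennreal (exp (- (\<Sum>i\<in>I. c i * B (\<rho> i) \<omega>))) \<partial>M)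
      = (\<integral>\<^sup>+v. ennreal (beta_density (\<delta> / 2) ((3 - \<delta>) / 2) v) *
          (\<integral>\<^sup>+\<omega>. ennreal (exp (- (\<Sum>i\<in>I. c i / sqrt v * W (v * \<rho> i) \<omega>))) \<partial>M) \<partial>lborel)"
proof -
  obtain W V where exc: "brownian_excursion M W"
    and V: "distributed M lborel V (\<lambda>v. ennreal (beta_density (\<delta> / 2) ((3 - \<delta>) / 2) v))"
    and indep: "prob_space.indep_set M (sets (vimage_algebra (space M) V borel)) (sets (history M W 1))"
    and B: "AE \<omega> in M. \<forall>t\<in>{0..1}. B t \<omega> = 1 / sqrt (V \<omega>) * W (V \<omega> * t) \<omega>"
    using meander unfolding generalized_bessel_meander_def by blast
  have ps: "prob_space M" and Wm: "\<And>t. t \<in> {0..1} \<Longrightarrow> W t \<in> borel_measurable M"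
    and cont: "\<And>\<omega>. \<omega> \<in> space M \<Longrightarrow> continuous_on {0..1} (\<lambda>t. W t \<omega>)"
    and W0: "\<And>\<omega>. \<omega> \<in> space M \<Longrightarrow> W 0 \<omega> = 0"
    using exc unfolding brownian_excursion_def by blast+
  interpret prob_space M by (rule ps)
  let ?H = "history M W 1" and ?\<beta> = "beta_density (\<delta> / 2) ((3 - \<delta>) / 2)" and ?k = "\<lambda>x::real. max 0 (min 1 x)"
  have H: "subalgebra M ?H" by (rule subalgebra_history) (rule Wm)
  define G where "G v \<omega> = ennreal (exp (- (\<Sum>i\<in>I. c i / sqrt v * W (?k (v * \<rho> i)) \<omega>)))" for v \<omega>
  have ev: "(\<lambda>(x, \<omega>). W (?k x) \<omega>) \<in> borel_measurable (borel \<Otimes>\<^sub>M ?H)"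
    by (rule borel_measurable_path_evaluation, rule measurable_history)
       (use Wm cont in \<open>auto simp: history_def\<close>)
  have "(\<lambda>z. W (?k (fst z * \<rho> i)) (snd z)) \<in> borel_measurable (borel \<Otimes>\<^sub>M ?H)" for i
    using measurable_compose[OF _ ev, of "\<lambda>z. (fst z * \<rho> i, snd z)" "borel \<Otimes>\<^sub>M ?H"] by simp
  then have G_meas: "(\<lambda>(v, \<omega>). G v \<omega>) \<in> borel_measurable (borel \<Otimes>\<^sub>M ?H)"
    unfolding G_def case_prod_beta by measurable
  have V01: "AE \<omega> in M. V \<omega> \<in> {0<..<1}"
  proof -
    have \<beta>: "(\<lambda>v. ennreal (?\<beta> v)) \<in> borel_measurable lborel"
      by (rule distributed_borel_measurable[OF V])
    have "AE v in density lborel (\<lambda>v. ennreal (?\<beta> v)). v \<in> {0<..<1}"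
      unfolding AE_density[OF \<beta>]
      by (intro AE_I2 impI beta_density_posD) (simp only: ennreal_less_zero_iff)
    then have "AE v in distr M lborel V. v \<in> {0<..<1}"
      by (simp only: distributed_distr_eq_density[OF V])
    then show ?thesis
      by (rule AE_distrD[OF distributed_measurable[OF V]])
  qed
  have clamp: "?k (v * \<rho> i) = v * \<rho> i" if "i \<in> I" "v \<in> {0<..<1}" for v i
  proof -
    have "0 \<le> v * \<rho> i" "v * \<rho> i \<le> 1"
      using \<rho>[OF that(1)] that(2) by (auto intro: mult_le_one)
    then show ?thesis by simp
  qed
  have "(\<integral>\<^sup>+\<omega>. ennreal (exp (- (\<Sum>i\<in>I. c i * B (\<rho> i) \<omega>))) \<partial>M) = (\<integral>\<^sup>+\<omega>. G (V \<omega>) \<omega> \<partial>M)"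
  proof (rule nn_integral_cong_AE)
    show "AE \<omega> in M. ennreal (exp (- (\<Sum>i\<in>I. c i * B (\<rho> i) \<omega>))) = G (V \<omega>) \<omega>"
      using B V01
    proof eventually_elim
      case (elim \<omega>)
      have "c i * B (\<rho> i) \<omega> = c i / sqrt (V \<omega>) * W (?k (V \<omega> * \<rho> i)) \<omega>" if "i \<in> I" for i
        using elim \<rho>[OF that] clamp[OF that elim(2)] by simp
      then show ?case unfolding G_def by simp
    qed
  qed
  also have "\<dots> = (\<integral>\<^sup>+v. ennreal (?\<beta> v) * (\<integral>\<^sup>+\<omega>. G v \<omega> \<partial>M) \<partial>lborel)"
    by (rule nn_integral_indep_density[OF V H indep G_meas])
  also have "\<dots> = (\<integral>\<^sup>+v. ennreal (?\<beta> v) *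
          (\<integral>\<^sup>+\<omega>. ennreal (exp (- (\<Sum>i\<in>I. c i / sqrt v * W (v * \<rho> i) \<omega>))) \<partial>M) \<partial>lborel)"
  proof (rule nn_integral_cong)
    fix v
    show "ennreal (?\<beta> v) * (\<integral>\<^sup>+\<omega>. G v \<omega> \<partial>M) = ennreal (?\<beta> v) *
          (\<integral>\<^sup>+\<omega>. ennreal (exp (- (\<Sum>i\<in>I. c i / sqrt v * W (v * \<rho> i) \<omega>))) \<partial>M)"
      unfolding G_def using clamp[of _ v] by (cases "v \<in> {0<..<1}") (simp_all add: beta_density_eq_0)
  qed
  finally have "(\<integral>\<^sup>+\<omega>. ennreal (exp (- (\<Sum>i\<in>I. c i * B (\<rho> i) \<omega>))) \<partial>M) = \<dots>" .
  moreover have "AE \<omega> in M. B 0 \<omega> = 0"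
    using B AE_space by eventually_elim (simp add: W0)
  ultimately show ?thesis using that exc by blast
qed

lemma borel_measurable_beta_density [measurable]: "beta_density a b \<in> borel_measurable borel"
  unfolding beta_density_def by measurable

lemma meander_constant:
  assumes "0 < \<delta>" "\<delta> < 3"
  shows "sqrt (2 / pi) / Beta (\<delta> / 2) ((3 - \<delta>) / 2) * Gamma ((3 - \<delta>) / 2) * 2 powr ((3 - \<delta>) / 2)
    = 2 / (2 powr (\<delta> / 2) * Gamma (\<delta> / 2))"
proof -
  have G: "0 < Gamma (\<delta> / 2)" "0 < Gamma ((3 - \<delta>) / 2)" using assms by (auto intro: Gamma_real_pos)
  have "\<delta> / 2 + (3 - \<delta>) / 2 = 1 / 2 + 1" by (simp add: field_simps)
  moreover have "Gamma (1 / 2 + 1) = sqrt pi / 2"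
    by (subst Gamma_plus1) (auto simp: Gamma_one_half_real elim!: nonpos_Ints_cases)
  ultimately have B: "Beta (\<delta> / 2) ((3 - \<delta>) / 2) = Gamma (\<delta> / 2) * Gamma ((3 - \<delta>) / 2) / (sqrt pi / 2)"
    by (simp only: Beta_def)
  have "2 powr ((3 - \<delta>) / 2) = 2 powr (1 + 1 / 2 - \<delta> / 2)" by (simp add: field_simps)
  also have "\<dots> = 2 * sqrt 2 / 2 powr (\<delta> / 2)" by (simp only: powr_diff powr_add powr_half_sqrt powr_one zero_le_numeral)
  finally have P: "2 powr ((3 - \<delta>) / 2) = 2 * sqrt 2 / 2 powr (\<delta> / 2)" .
  have "sqrt (2 / pi) / Beta (\<delta> / 2) ((3 - \<delta>) / 2) * Gamma ((3 - \<delta>) / 2) * 2 powr ((3 - \<delta>) / 2)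
    = (sqrt 2 * sqrt 2) / (2 powr (\<delta> / 2) * Gamma (\<delta> / 2))"
    unfolding B P using G by (simp add: real_sqrt_divide field_simps)
  then show ?thesis by simp
qed

text \<open>The exponents in the Beta density, the scaling factor \<open>v powr (- 3 / 2)\<close> of the excursion
  and the Jacobian of \<open>v = 1 / (1 + r)\<close> are such that all powers of \<open>1 + r\<close> cancel.\<close>

lemma beta_density_inverse:
  assumes "0 < r"
  shows "1 / (1 + r)\<^sup>2 * (beta_density (\<delta> / 2) ((3 - \<delta>) / 2) (1 / (1 + r)) * (k / (1 / (1 + r) * sqrt (1 / (1 + r)))))
    = k / Beta (\<delta> / 2) ((3 - \<delta>) / 2) * r powr ((3 - \<delta>) / 2 - 1)"
proof -
  define w where "w = 1 + r"
  have w: "1 < w" "0 < w" using assms by (auto simp: w_def)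
  have 1: "1 / w\<^sup>2 = w powr (- 2)" using w by (simp add: powr_minus_divide)
  have 2: "(1 / w) powr a = w powr (- a)" for a using w by (simp add: powr_divide powr_minus_divide)
  have 3: "(1 - 1 / w) powr a = r powr a * w powr (- a)" for a
  proof -
    have "1 - 1 / w = r / w" using w by (simp add: w_def field_simps)
    then show ?thesis using assms w by (simp add: powr_divide powr_minus_divide)
  qed
  have 4: "k / (1 / w * sqrt (1 / w)) = k * w powr (3 / 2)"
  proof -
    have "w powr (3 / 2) = w powr (1 + 1 / 2)" by simp
    also have "\<dots> = w * sqrt w" using w by (simp only: powr_add powr_half_sqrt powr_one less_imp_le)
    finally show ?thesis using w by (simp add: real_sqrt_divide)
  qed
  have "w powr (- 2) * w powr (- (\<delta> / 2 - 1)) * w powr (- ((3 - \<delta>) / 2 - 1)) * w powr (3 / 2)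
     = w powr (- 2 + - (\<delta> / 2 - 1) + - ((3 - \<delta>) / 2 - 1) + 3 / 2)"
    by (simp only: powr_add)
  also have "- 2 + - (\<delta> / 2 - 1) + - ((3 - \<delta>) / 2 - 1) + 3 / 2 = 0" by (simp add: field_simps)
  finally have 5: "w powr (- 2) * w powr (- (\<delta> / 2 - 1)) * w powr (- ((3 - \<delta>) / 2 - 1)) * w powr (3 / 2) = 1"
    using w by simp
  have "beta_density (\<delta> / 2) ((3 - \<delta>) / 2) (1 / w)
      = w powr (- (\<delta> / 2 - 1)) * (r powr ((3 - \<delta>) / 2 - 1) * w powr (- ((3 - \<delta>) / 2 - 1))) / Beta (\<delta> / 2) ((3 - \<delta>) / 2)"
    unfolding beta_density_def 2 3 using w by simp
  then have "1 / w\<^sup>2 * (beta_density (\<delta> / 2) ((3 - \<delta>) / 2) (1 / w) * (k / (1 / w * sqrt (1 / w))))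
    = (w powr (- 2) * w powr (- (\<delta> / 2 - 1)) * w powr (- ((3 - \<delta>) / 2 - 1)) * w powr (3 / 2)) *
      (k / Beta (\<delta> / 2) ((3 - \<delta>) / 2) * r powr ((3 - \<delta>) / 2 - 1))"
    unfolding 1 4 by (simp only:) simp
  also have "\<dots> = k / Beta (\<delta> / 2) ((3 - \<delta>) / 2) * r powr ((3 - \<delta>) / 2 - 1)"
    by (simp only: 5 mult_1_left)
  finally show ?thesis unfolding w_def .
qed

lemma gamma_mixture_power:
  assumes "0 < b" "0 < (u::real)"
  shows "Gamma b / (u\<^sup>2 / 2) powr b * u = Gamma b * 2 powr b * u powr (1 - 2 * b)"
proof -
  have "(u\<^sup>2 / 2) powr b = u powr (2 * b) / 2 powr b"
    using assms by (simp add: powr_divide powr_powr flip: powr_numeral)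
  then show ?thesis using assms by (simp add: powr_diff)
qed

text \<open>Averaging over the Beta variable turns the closing function \<open>u * exp (- r u\<^sup>2 / 2)\<close>, with
  \<open>r = 1 / v - 1\<close>, into a multiple of \<open>u powr (\<delta> - 2)\<close>: after the substitution \<open>v = 1 / (1 + r)\<close> this is a
  Gamma integral in \<open>r\<close>.\<close>

lemma beta_mixture_gaussian:
  assumes \<delta>: "0 < \<delta>" "\<delta> < 3" and F [measurable]: "F \<in> borel_measurable borel"
    and F0: "\<And>u. 0 \<le> F u" and F_neg: "\<And>u. u \<le> 0 \<Longrightarrow> F u = 0"
  shows "(\<integral>\<^sup>+v. ennreal (beta_density (\<delta> / 2) ((3 - \<delta>) / 2) v) * (ennreal (sqrt (2 / pi) / (v * sqrt v)) *
      (\<integral>\<^sup>+u. ennreal (u * exp (- ((1 / v - 1) * u\<^sup>2 / 2)) * F u) \<partial>lborel)) \<partial>lborel)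
    = ennreal (2 / (2 powr (\<delta> / 2) * Gamma (\<delta> / 2))) * (\<integral>\<^sup>+u. ennreal (u powr (\<delta> - 2) * F u) \<partial>lborel)"
proof -
  define b where "b = (3 - \<delta>) / 2"
  define C where "C = sqrt (2 / pi) / Beta (\<delta> / 2) b"
  have b: "0 < b" using \<delta> by (simp add: b_def)
  have Bpos: "0 < Beta (\<delta> / 2) b" using \<delta> b by (simp add: Beta_def Gamma_real_pos)
  then have C0: "0 \<le> C" by (simp add: C_def)
  have \<beta>0: "0 \<le> beta_density (\<delta> / 2) b v" for v
    using Bpos by (simp add: beta_density_def)
  let ?I = "\<lambda>r. \<integral>\<^sup>+u. ennreal (u * exp (- (r * u\<^sup>2 / 2)) * F u) \<partial>lborel"
  let ?f = "\<lambda>v. ennreal (beta_density (\<delta> / 2) b v) * (ennreal (sqrt (2 / pi) / (v * sqrt v)) * ?I (1 / v - 1))"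
  have uF: "0 \<le> u * F u" for u using F0[of u] F_neg[of u] by (cases "0 < u") auto
  have "(\<integral>\<^sup>+v. ?f v \<partial>lborel) = (\<integral>\<^sup>+v. indicator {0<..<1} v * ?f v \<partial>lborel)"
  proof (rule nn_integral_cong)
    show "?f v = indicator {0<..<1} v * ?f v" for v
      by (cases "v \<in> {0<..<1}") (simp_all add: beta_density_eq_0 del: greaterThanLessThan_iff)
  qed
  also have "\<dots> = (\<integral>\<^sup>+r. indicator {0<..} r * (ennreal (1 / (1 + r)\<^sup>2) * ?f (1 / (1 + r))) \<partial>lborel)"
    by (rule nn_integral_substitute_inverse) measurable
  also have "\<dots> = (\<integral>\<^sup>+r. ennreal (indicator {0<..} r * (C * r powr (b - 1))) * ?I r \<partial>lborel)"
  proof (rule nn_integral_cong)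
    fix r
    show "indicator {0<..} r * (ennreal (1 / (1 + r)\<^sup>2) * ?f (1 / (1 + r)))
      = ennreal (indicator {0<..} r * (C * r powr (b - 1))) * ?I r"
    proof (cases "0 < r")
      case True
      let ?A = "ennreal (1 / (1 + r)\<^sup>2)" and ?B = "ennreal (beta_density (\<delta> / 2) b (1 / (1 + r)))"
        and ?K = "ennreal (sqrt (2 / pi) / (1 / (1 + r) * sqrt (1 / (1 + r))))"
      have "0 \<le> 1 / (1 + r)\<^sup>2" "0 \<le> sqrt (2 / pi) / (1 / (1 + r) * sqrt (1 / (1 + r)))" using True by auto
      then have "?A * (?B * ?K) = ennreal (1 / (1 + r)\<^sup>2 *
          (beta_density (\<delta> / 2) b (1 / (1 + r)) * (sqrt (2 / pi) / (1 / (1 + r) * sqrt (1 / (1 + r))))))"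
        using \<beta>0[of "1 / (1 + r)"] by (simp only: ennreal_mult mult_nonneg_nonneg)
      also have "\<dots> = ennreal (C * r powr (b - 1))"
        unfolding C_def b_def by (simp only: beta_density_inverse[OF True])
      finally have ABK: "?A * (?B * ?K) = ennreal (C * r powr (b - 1))" .
      have r: "1 / (1 / (1 + r)) - 1 = r" by simp
      have "?A * ?f (1 / (1 + r)) = (?A * (?B * ?K)) * ?I r"
        unfolding r by (simp only: mult.assoc)
      also have "\<dots> = ennreal (C * r powr (b - 1)) * ?I r" by (simp only: ABK)
      finally have X: "?A * ?f (1 / (1 + r)) = ennreal (C * r powr (b - 1)) * ?I r" .
      have "indicator {0<..} r = (1::ennreal)" "indicator {0<..} r = (1::real)" using True by auto
      then show ?thesis by (simp only: X mult_1_left)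
    qed simp
  qed
  also have "\<dots> = (\<integral>\<^sup>+r. (\<integral>\<^sup>+u. ennreal (C * (u * F u)) *
      ennreal (indicator {0<..} r * (r powr (b - 1) * exp (- (u\<^sup>2 / 2 * r)))) \<partial>lborel) \<partial>lborel)"
  proof (rule nn_integral_cong)
    fix r
    have "ennreal (indicator {0<..} r * (C * r powr (b - 1))) * ?I r
      = (\<integral>\<^sup>+u. ennreal (indicator {0<..} r * (C * r powr (b - 1))) * ennreal (u * exp (- (r * u\<^sup>2 / 2)) * F u) \<partial>lborel)"
      by (rule nn_integral_cmult[symmetric]) measurable
    moreover
    have "ennreal (indicator {0<..} r * (C * r powr (b - 1))) * ennreal (u * exp (- (r * u\<^sup>2 / 2)) * F u)
      = ennreal (C * (u * F u)) * ennreal (indicator {0<..} r * (r powr (b - 1) * exp (- (u\<^sup>2 / 2 * r))))" for u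
    proof -
      have "ennreal (indicator {0<..} r * (C * r powr (b - 1))) * ennreal (u * exp (- (r * u\<^sup>2 / 2)) * F u)
        = ennreal (indicator {0<..} r * (C * r powr (b - 1)) * (u * exp (- (r * u\<^sup>2 / 2)) * F u))"
        using C0 by (intro ennreal_mult'[symmetric]) (simp add: indicator_def)
      also have "indicator {0<..} r * (C * r powr (b - 1)) * (u * exp (- (r * u\<^sup>2 / 2)) * F u)
        = C * (u * F u) * (indicator {0<..} r * (r powr (b - 1) * exp (- (u\<^sup>2 / 2 * r))))"
        by (simp add: ac_simps)
      also have "ennreal \<dots> = ennreal (C * (u * F u)) * ennreal (indicator {0<..} r * (r powr (b - 1) * exp (- (u\<^sup>2 / 2 * r))))"
        using C0 uF[of u] by (intro ennreal_mult') simp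
      finally show ?thesis .
    qed
    ultimately show "ennreal (indicator {0<..} r * (C * r powr (b - 1))) * ?I r
      = (\<integral>\<^sup>+u. ennreal (C * (u * F u)) * ennreal (indicator {0<..} r * (r powr (b - 1) * exp (- (u\<^sup>2 / 2 * r)))) \<partial>lborel)"
      by (simp only:)
  qed
  also have "\<dots> = (\<integral>\<^sup>+u. (\<integral>\<^sup>+r. ennreal (C * (u * F u)) *
      ennreal (indicator {0<..} r * (r powr (b - 1) * exp (- (u\<^sup>2 / 2 * r)))) \<partial>lborel) \<partial>lborel)"
    by (rule lborel_pair.Fubini') measurable
  also have "\<dots> = (\<integral>\<^sup>+u. ennreal (C * Gamma b * 2 powr b) * ennreal (u powr (\<delta> - 2) * F u) \<partial>lborel)"
  proof (rule nn_integral_cong)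
    fix u
    have "(\<integral>\<^sup>+r. ennreal (C * (u * F u)) * ennreal (indicator {0<..} r * (r powr (b - 1) * exp (- (u\<^sup>2 / 2 * r)))) \<partial>lborel)
      = ennreal (C * (u * F u)) * (\<integral>\<^sup>+r. ennreal (indicator {0<..} r * (r powr (b - 1) * exp (- (u\<^sup>2 / 2 * r)))) \<partial>lborel)"
      by (rule nn_integral_cmult) measurable
    also have "\<dots> = ennreal (C * Gamma b * 2 powr b) * ennreal (u powr (\<delta> - 2) * F u)"
    proof (cases "0 < u")
      case True
      have e: "1 - 2 * b = \<delta> - 2" by (simp add: b_def field_simps)
      have "C * (u * F u) * (Gamma b / (u\<^sup>2 / 2) powr b) = C * F u * (Gamma b / (u\<^sup>2 / 2) powr b * u)"
        by simp
      also have "\<dots> = C * Gamma b * 2 powr b * (u powr (\<delta> - 2) * F u)"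
        unfolding gamma_mixture_power[OF b True] e by simp
      finally have "C * (u * F u) * (Gamma b / (u\<^sup>2 / 2) powr b) = C * Gamma b * 2 powr b * (u powr (\<delta> - 2) * F u)" .
      then show ?thesis
        using True C0 F0[of u] Gamma_real_pos[OF b] nn_integral_gamma_rate[OF b, of "u\<^sup>2 / 2"]
        by (simp flip: ennreal_mult)
    qed (simp add: F_neg)
    finally show "(\<integral>\<^sup>+r. ennreal (C * (u * F u)) * ennreal (indicator {0<..} r * (r powr (b - 1) * exp (- (u\<^sup>2 / 2 * r)))) \<partial>lborel)
      = ennreal (C * Gamma b * 2 powr b) * ennreal (u powr (\<delta> - 2) * F u)" .
  qed
  also have "\<dots> = ennreal (C * Gamma b * 2 powr b) * (\<integral>\<^sup>+u. ennreal (u powr (\<delta> - 2) * F u) \<partial>lborel)"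
    by (rule nn_integral_cmult) measurable
  also have "C * Gamma b * 2 powr b = 2 / (2 powr (\<delta> / 2) * Gamma (\<delta> / 2))"
    unfolding C_def b_def by (rule meander_constant[OF \<delta>])
  finally show ?thesis unfolding b_def .
qed

section \<open>The duality formula\<close>

text \<open>When \<open>t d < 1\<close>, all observation times of the meander are positive and every Gaussian weight
  except possibly the one belonging to \<open>t 1 - t 0\<close> is nontrivial, so that the duality applies. Both sides equal
  a multiple of \<open>\<integral>\<^sup>+u. u powr (\<delta> - 2) * cauchy_chain \<sigma> \<tau> d u\<close>. The case \<open>d = 0\<close>, in which no chain for the excursion exists, says
  that the right-hand side is normalised.\<close>

lemma meander_laplace_interior:
  fixes \<delta> :: real
    and M :: "'a measure" and B :: "real \<Rightarrow> 'a \<Rightarrow> real"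
    and P :: "real \<Rightarrow> 'b measure" and X :: "real \<Rightarrow> 'b \<Rightarrow> real"
    and d :: nat and s t :: "nat \<Rightarrow> real"
  assumes \<delta>: "0 < \<delta>" "\<delta> < 3"
    and meander: "generalized_bessel_meander M \<delta> B"
    and markov: "\<And>x. x > 0 \<Longrightarrow> markov_process_from trans_density (P x) X x"
    and s: "s 0 = 0" "strict_mono_on {0..d} s"
    and t0: "t 0 = 0" and t1: "0 \<le> t 1" and t: "strict_mono_on {1..d} t"
    and td: "t d < 1" and t_end: "t (d + 1) = 1"
  shows "(\<integral>\<omega>. exp (- (\<Sum>k=1..d. (s k - s (k - 1)) * B (1 - t k) \<omega>)) \<partial>M)
       = 1 / (2 powr (\<delta> / 2) * Gamma (\<delta> / 2))
         * (LBINT x:{0<..}.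
              (\<integral>\<omega>. exp (- (1 / 2) * (\<Sum>k=0..d. (t (k + 1) - t k) * X (s k) \<omega>)) \<partial>P x)
              * x powr (\<delta> / 2 - 1))"
proof -
  define \<sigma> where "\<sigma> j = s (d - j) - s (d - Suc j)" for j
  define \<tau> where "\<tau> j = t (Suc d - j) - t (d - j)" for j
  define F where "F = cauchy_chain \<sigma> \<tau> d"
  define J where "J x = (\<integral>\<omega>. exp (- (1 / 2) * (\<Sum>k=0..d. (t (k + 1) - t k) * X (s k) \<omega>)) \<partial>P x)" for x
  have \<sigma>_pos: "0 < \<sigma> j" if "j < d" for j
    using strict_mono_onD[OF s(2), of "d - Suc j" "d - j"] that by (simp add: \<sigma>_def)
  have \<tau>_pos: "0 < \<tau> j" if "j < d" for j
  proof (cases j)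
    case 0
    then show ?thesis using td t_end by (simp add: \<tau>_def)
  next
    case (Suc i)
    then have "d - j \<in> {1..d}" "Suc d - j \<in> {1..d}" "d - j < Suc d - j" using that by auto
    then show ?thesis using strict_mono_onD[OF t] by (simp add: \<tau>_def)
  qed
  have \<tau>_last: "0 \<le> \<tau> d" using t0 t1 by (simp add: \<tau>_def)
  have \<tau>_nonneg: "0 \<le> \<tau> j" if "j \<le> d" for j
    using \<tau>_pos[of j] \<tau>_last that by (cases "j = d") auto
  have \<tau>_sum: "(\<Sum>j<i. \<tau> j) = 1 - t (Suc d - i)" if "i \<le> Suc d" for i
    using that
  proof (induction i)
    case (Suc i)
    then show ?case by (simp add: \<tau>_def Suc_diff_le)
  qed (use t_end in simp)
  have t_step: "t k \<le> t (Suc k)" if "k \<le> d" for k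
    using \<tau>_nonneg[of "d - k"] that by (simp add: \<tau>_def Suc_diff_le)
  have J: "ennreal (J x) = radial_chain \<sigma> \<tau> d x" if "0 < x" for x
    unfolding J_def by (rule markov_laplace[OF markov[OF that] s]) (simp_all add: t_step \<sigma>_def \<tau>_def)
  have J0: "0 \<le> J x" for x unfolding J_def by (rule integral_nonneg_AE) simp
  have F0: "0 \<le> F u" for u unfolding F_def by (rule cauchy_chain_nonneg) (rule \<sigma>_pos)
  let ?I = "\<integral>\<^sup>+u. ennreal (u powr (\<delta> - 2) * F u) \<partial>lborel"
  let ?R = "\<integral>\<^sup>+x. ennreal (indicator {0<..} x * (J x * x powr (\<delta> / 2 - 1))) \<partial>lborel"
  have R_eq: "?R = (\<integral>\<^sup>+x. indicator {0<..} x * (radial_chain \<sigma> \<tau> d x * ennreal (x powr (\<delta> / 2 - 1))) \<partial>lborel)"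
  proof (rule nn_integral_cong)
    fix x
    show "ennreal (indicator {0<..} x * (J x * x powr (\<delta> / 2 - 1)))
      = indicator {0<..} x * (radial_chain \<sigma> \<tau> d x * ennreal (x powr (\<delta> / 2 - 1)))"
      by (cases "0 < x") (simp_all add: J[symmetric] ennreal_mult' J0)
  qed
  have RI: "?R = ennreal 2 * ?I"
  proof -
    have "?R = (\<integral>\<^sup>+u. indicator {0<..} u * (ennreal (2 * u) *
        (radial_chain \<sigma> \<tau> d (u\<^sup>2) * ennreal (u\<^sup>2 powr (\<delta> / 2 - 1)))) \<partial>lborel)"
      unfolding R_eq by (rule nn_integral_substitute_square) measurable
    also have "\<dots> = (\<integral>\<^sup>+u. ennreal 2 * ennreal (u powr (\<delta> - 2) * F u) \<partial>lborel)"
    proof (rule nn_integral_cong)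
      fix u
      show "indicator {0<..} u * (ennreal (2 * u) * (radial_chain \<sigma> \<tau> d (u\<^sup>2) * ennreal (u\<^sup>2 powr (\<delta> / 2 - 1))))
        = ennreal 2 * ennreal (u powr (\<delta> - 2) * F u)"
      proof (cases "0 < u")
        case True
        have p: "u\<^sup>2 powr (\<delta> / 2 - 1) = u powr (\<delta> - 2)"
        proof -
          have "u\<^sup>2 powr (\<delta> / 2 - 1) = (u powr 2) powr (\<delta> / 2 - 1)" using True by (simp add: powr_numeral)
          also have "\<dots> = u powr (2 * (\<delta> / 2 - 1))" by (rule powr_powr)
          finally show ?thesis by (simp add: right_diff_distrib)
        qed
        have rc: "radial_chain \<sigma> \<tau> d (u\<^sup>2) * ennreal u = ennreal (F u)"
          unfolding F_def by (rule radial_chain_eq_cauchy_chain) (use \<sigma>_pos \<tau>_pos True in auto)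
        have "ennreal (2 * u) * (radial_chain \<sigma> \<tau> d (u\<^sup>2) * ennreal (u powr (\<delta> - 2)))
          = ennreal 2 * (ennreal (u powr (\<delta> - 2)) * (radial_chain \<sigma> \<tau> d (u\<^sup>2) * ennreal u))"
          using True by (simp add: ennreal_mult ac_simps)
        also have "\<dots> = ennreal 2 * ennreal (u powr (\<delta> - 2) * F u)"
          unfolding rc by (simp add: ennreal_mult')
        finally show ?thesis using True unfolding p by simp
      qed (simp add: F_def cauchy_chain_eq_0)
    qed
    also have "\<dots> = ennreal 2 * ?I"
      unfolding F_def by (rule nn_integral_cmult) measurable
    finally show ?thesis .
  qed
  have rhs: "(LBINT x:{0<..}. J x * x powr (\<delta> / 2 - 1)) = enn2real ?R"
  proof -
    have "(\<lambda>x. indicator {0<..} x * (J x * x powr (\<delta> / 2 - 1)))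
      = (\<lambda>x. indicator {0<..} x * (enn2real (radial_chain \<sigma> \<tau> d x) * x powr (\<delta> / 2 - 1)))"
    proof
      fix x
      show "indicator {0<..} x * (J x * x powr (\<delta> / 2 - 1))
        = indicator {0<..} x * (enn2real (radial_chain \<sigma> \<tau> d x) * x powr (\<delta> / 2 - 1))"
        by (cases "0 < x") (simp_all add: J[symmetric] J0)
    qed
    moreover have "(\<lambda>x. indicator {0<..} x * (enn2real (radial_chain \<sigma> \<tau> d x) * x powr (\<delta> / 2 - 1))) \<in> borel_measurable borel"
      by measurable
    ultimately have m: "(\<lambda>x. indicator {0<..} x * (J x * x powr (\<delta> / 2 - 1))) \<in> borel_measurable lborel"
      by simp
    show ?thesis
      unfolding set_lebesgue_integral_def real_scaleR_def
      by (rule integral_eq_nn_integral[OF m]) (simp add: J0)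
  qed
  have B_meas: "\<And>r. r \<in> {0..1} \<Longrightarrow> B r \<in> borel_measurable M"
    using meander unfolding generalized_bessel_meander_def by blast
  define \<rho> where "\<rho> i = (\<Sum>j<i. \<tau> j)" for i
  have \<rho>: "0 \<le> \<rho> i \<and> \<rho> i \<le> 1" if "i \<in> {1..d}" for i
  proof
    show "0 \<le> \<rho> i" unfolding \<rho>_def by (rule sum_nonneg) (use that in \<open>auto intro: \<tau>_nonneg\<close>)
    have "(\<Sum>j<i. \<tau> j) \<le> (\<Sum>j<Suc d. \<tau> j)"
      by (rule sum_mono2) (use that in \<open>auto intro: \<tau>_nonneg\<close>)
    then show "\<rho> i \<le> 1" unfolding \<rho>_def using \<tau>_sum[of "Suc d"] t0 by simp
  qed
  have sum_eq: "(\<Sum>k=1..d. (s k - s (k - 1)) * B (1 - t k) \<omega>) = (\<Sum>i=1..d. \<sigma> (i - 1) * B (\<rho> i) \<omega>)" for \<omega>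
  proof (rule sum.reindex_bij_witness[where i = "\<lambda>i. Suc d - i" and j = "\<lambda>k. Suc d - k"])
    fix k assume k: "k \<in> {1..d}"
    then have e: "d - (Suc d - k - 1) = k" "d - Suc (Suc d - k - 1) = k - 1" "Suc d - (Suc d - k) = k" by auto
    have "\<sigma> (Suc d - k - 1) = s k - s (k - 1)" unfolding \<sigma>_def e ..
    moreover have "\<rho> (Suc d - k) = 1 - t k" unfolding \<rho>_def using \<tau>_sum[of "Suc d - k"] e by simp
    ultimately show "\<sigma> (Suc d - k - 1) * B (\<rho> (Suc d - k)) \<omega> = (s k - s (k - 1)) * B (1 - t k) \<omega>"
      by simp
  qed auto
  have lhs: "(\<integral>\<omega>. exp (- (\<Sum>i=1..d. \<sigma> (i - 1) * B (\<rho> i) \<omega>)) \<partial>M)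
    = enn2real (\<integral>\<^sup>+\<omega>. ennreal (exp (- (\<Sum>i=1..d. \<sigma> (i - 1) * B (\<rho> i) \<omega>))) \<partial>M)"
  proof (rule integral_eq_nn_integral)
    have "B (\<rho> i) \<in> borel_measurable M" if "i \<in> {1..d}" for i using \<rho>[OF that] by (intro B_meas) auto
    then show "(\<lambda>\<omega>. exp (- (\<Sum>i=1..d. \<sigma> (i - 1) * B (\<rho> i) \<omega>))) \<in> borel_measurable M" by measurable
  qed simp
  define c where "c = 1 / (2 powr (\<delta> / 2) * Gamma (\<delta> / 2))"
  have c: "0 < c" using \<delta> by (simp add: c_def Gamma_real_pos)
  obtain W where exc: "brownian_excursion M W"
    and mixture: "(\<integral>\<^sup>+\<omega>. ennreal (exp (- (\<Sum>i=1..d. \<sigma> (i - 1) * B (\<rho> i) \<omega>))) \<partial>M)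
      = (\<integral>\<^sup>+v. ennreal (beta_density (\<delta> / 2) ((3 - \<delta>) / 2) v) *
          (\<integral>\<^sup>+\<omega>. ennreal (exp (- (\<Sum>i=1..d. \<sigma> (i - 1) / sqrt v * W (v * \<rho> i) \<omega>))) \<partial>M) \<partial>lborel)"
    using meander_laplace_mixture[OF meander, of "{1..d}" \<rho> "\<lambda>i. \<sigma> (i - 1)"] \<rho> by blast
  have "(\<integral>\<^sup>+\<omega>. ennreal (exp (- (\<Sum>i=1..d. \<sigma> (i - 1) * B (\<rho> i) \<omega>))) \<partial>M) = ennreal c * ?R"
  proof (cases d)
    case 0
    have "prob_space M" using exc by (simp add: brownian_excursion_def)
    then have "(\<integral>\<^sup>+\<omega>. ennreal (exp (- (\<Sum>i=1..d. \<sigma> (i - 1) * B (\<rho> i) \<omega>))) \<partial>M) = 1"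
      using 0 by (simp add: prob_space.emeasure_space_1)
    moreover have "?R = (\<integral>\<^sup>+x. ennreal (indicator {0<..} x * (x powr (\<delta> / 2 - 1) * exp (- (1 / 2 * x)))) \<partial>lborel)"
      unfolding R_eq
    proof (rule nn_integral_cong)
      fix x
      have "\<tau> 0 = 1" using 0 t0 t_end by (simp add: \<tau>_def)
      then show "indicator {0<..} x * (radial_chain \<sigma> \<tau> d x * ennreal (x powr (\<delta> / 2 - 1)))
        = ennreal (indicator {0<..} x * (x powr (\<delta> / 2 - 1) * exp (- (1 / 2 * x))))"
        using 0 by (cases "0 < x") (simp_all add: mult.commute flip: ennreal_mult)
    qed
    moreover have "\<dots> = ennreal (1 / c)"
      using nn_integral_gamma_rate[of "\<delta> / 2" "1 / 2"] \<delta> by (simp add: c_def powr_divide mult.commute)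
    ultimately show ?thesis using c by (simp flip: ennreal_mult)
  next
    case (Suc n)
    have "(\<integral>\<^sup>+\<omega>. ennreal (exp (- (\<Sum>i=1..d. \<sigma> (i - 1) * B (\<rho> i) \<omega>))) \<partial>M)
      = (\<integral>\<^sup>+v. ennreal (beta_density (\<delta> / 2) ((3 - \<delta>) / 2) v) * (ennreal (sqrt (2 / pi) / (v * sqrt v)) *
          (\<integral>\<^sup>+u. ennreal (u * exp (- ((1 / v - 1) * u\<^sup>2 / 2)) * F u) \<partial>lborel)) \<partial>lborel)"
      unfolding mixture
    proof (rule nn_integral_cong)
      fix v
      show "ennreal (beta_density (\<delta> / 2) ((3 - \<delta>) / 2) v) *
          (\<integral>\<^sup>+\<omega>. ennreal (exp (- (\<Sum>i=1..d. \<sigma> (i - 1) / sqrt v * W (v * \<rho> i) \<omega>))) \<partial>M)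
        = ennreal (beta_density (\<delta> / 2) ((3 - \<delta>) / 2) v) * (ennreal (sqrt (2 / pi) / (v * sqrt v)) *
          (\<integral>\<^sup>+u. ennreal (u * exp (- ((1 / v - 1) * u\<^sup>2 / 2)) * F u) \<partial>lborel))"
      proof (cases "v \<in> {0<..<1}")
        case True
        have "(\<integral>\<^sup>+\<omega>. ennreal (exp (- (\<Sum>i=1..Suc n. \<sigma> (i - 1) / sqrt v * W (v * (\<Sum>j<i. \<tau> j)) \<omega>))) \<partial>M)
          = ennreal (sqrt (2 / pi) / (v * sqrt v)) *
            (\<integral>\<^sup>+u. ennreal (u * exp (- ((1 / v - 1) * u\<^sup>2 / 2)) * cauchy_chain \<sigma> \<tau> (Suc n) u) \<partial>lborel)"
        proof (rule scaled_excursion_laplace[OF exc])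
          show "(\<Sum>j\<le>Suc n. \<tau> j) = 1"
            using \<tau>_sum[of "Suc d"] t0 unfolding Suc by (simp only: lessThan_Suc_atMost) simp
        qed (use True Suc \<sigma>_pos \<tau>_pos \<tau>_last in auto)
        then show ?thesis unfolding \<rho>_def F_def Suc by (simp only:)
      qed (simp add: beta_density_eq_0 del: greaterThanLessThan_iff)
    qed
    also have "\<dots> = ennreal (2 / (2 powr (\<delta> / 2) * Gamma (\<delta> / 2))) * ?I"
      by (rule beta_mixture_gaussian[OF \<delta> _ F0]) (simp_all add: F_def cauchy_chain_eq_0)
    also have "\<dots> = ennreal c * ?R"
    proof -
      have "2 / (2 powr (\<delta> / 2) * Gamma (\<delta> / 2)) = c * 2" by (simp add: c_def)
      then show ?thesis unfolding RI using c by (simp only: ennreal_mult less_imp_le zero_le_numeral mult.assoc)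
    qed
    finally show ?thesis .
  qed
  then show ?thesis
    unfolding sum_eq lhs J_def[symmetric] rhs c_def[symmetric]
    using c by (simp add: enn2real_mult)
qed

text \<open>If \<open>t d = 1\<close>, the last term on the left vanishes since the meander starts at \<open>0\<close>, and the last
  term on the right vanishes since its coefficient is \<open>t (d + 1) - t d = 0\<close>. The statement is then
  the one for \<open>d - 1\<close>, with the same \<open>s\<close> and \<open>t\<close>.\<close>

theorem corollary3p3:
  fixes \<delta> :: real
    and M :: "'a measure" and B :: "real \<Rightarrow> 'a \<Rightarrow> real"
    and P :: "real \<Rightarrow> 'b measure" and X :: "real \<Rightarrow> 'b \<Rightarrow> real"
    and d :: nat and s t :: "nat \<Rightarrow> real"
  assumes "0 < \<delta>" and "\<delta> < 3"
    and "generalized_bessel_meander M \<delta> B"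
    and "\<And>x. x > 0 \<Longrightarrow> markov_process_from trans_density (P x) X x"
    and "d \<ge> 1"
    and "s 0 = 0" and "strict_mono_on {0..d} s"
    and "t 0 = 0" and "0 \<le> t 1" and "strict_mono_on {1..d} t"
    and "t d \<le> 1" and "t (d + 1) = 1"
  shows "(\<integral>\<omega>. exp (- (\<Sum>k=1..d. (s k - s (k - 1)) * B (1 - t k) \<omega>)) \<partial>M)
       = 1 / (2 powr (\<delta> / 2) * Gamma (\<delta> / 2))
         * (LBINT x:{0<..}.
              (\<integral>\<omega>. exp (- (1 / 2) * (\<Sum>k=0..d. (t (k + 1) - t k) * X (s k) \<omega>)) \<partial>P x)
              * x powr (\<delta> / 2 - 1))"
proof (cases "t d < 1")
  case True
  then show ?thesis by (intro meander_laplace_interior assms)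
next
  case False
  then have td: "t d = 1" using assms by simp
  obtain n where n: "d = Suc n" using assms by (cases d) auto
  have tn: "t n < 1"
  proof (cases n)
    case (Suc m)
    then show ?thesis using strict_mono_onD[OF assms(10), of n d] td n by simp
  qed (simp add: assms)
  have "(\<integral>\<omega>. exp (- (\<Sum>k=1..n. (s k - s (k - 1)) * B (1 - t k) \<omega>)) \<partial>M)
       = 1 / (2 powr (\<delta> / 2) * Gamma (\<delta> / 2))
         * (LBINT x:{0<..}.
              (\<integral>\<omega>. exp (- (1 / 2) * (\<Sum>k=0..n. (t (k + 1) - t k) * X (s k) \<omega>)) \<partial>P x)
              * x powr (\<delta> / 2 - 1))"
    using assms td n tn
    by (intro meander_laplace_interior) (auto intro: monotone_on_subset)
  moreover have "(\<Sum>k=0..d. (t (k + 1) - t k) * X (s k) \<omega>) = (\<Sum>k=0..n. (t (k + 1) - t k) * X (s k) \<omega>)" for \<omega>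
    using td assms(12) by (simp add: n)
  moreover have "(\<integral>\<omega>. exp (- (\<Sum>k=1..d. (s k - s (k - 1)) * B (1 - t k) \<omega>)) \<partial>M)
    = (\<integral>\<omega>. exp (- (\<Sum>k=1..n. (s k - s (k - 1)) * B (1 - t k) \<omega>)) \<partial>M)"
  proof (rule integral_cong_AE)
    have B_meas: "B r \<in> borel_measurable M" if "r \<in> {0..1}" for r
      using assms(3) that unfolding generalized_bessel_meander_def by blast
    have t_le: "t 1 \<le> t k" "t k \<le> t d" if "k \<in> {1..d}" for k
      using that assms(5) by (auto intro!: strict_mono_on_leD[OF assms(10)])
    have "B (1 - t k) \<in> borel_measurable M" if "k \<in> {1..d}" for k
      using t_le[OF that] assms(9) td by (intro B_meas) auto
    then show "(\<lambda>\<omega>. exp (- (\<Sum>k=1..d. (s k - s (k - 1)) * B (1 - t k) \<omega>))) \<in> borel_measurable M"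
      "(\<lambda>\<omega>. exp (- (\<Sum>k=1..n. (s k - s (k - 1)) * B (1 - t k) \<omega>))) \<in> borel_measurable M"
      unfolding n by measurable
    have "AE \<omega> in M. B 0 \<omega> = 0"
      by (rule meander_laplace_mixture[OF assms(3), of "{}"]) auto
    then show "AE \<omega> in M. exp (- (\<Sum>k=1..d. (s k - s (k - 1)) * B (1 - t k) \<omega>))
        = exp (- (\<Sum>k=1..n. (s k - s (k - 1)) * B (1 - t k) \<omega>))"
      by eventually_elim (simp add: n td[unfolded n])
  qed
  ultimately show ?thesis by simp
qed

end
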